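(* Let $P$ and $Q$ be probabilities on $\mathbb{R}^d$ with means $\mu_1,\mu_2$ and positive definite covariance matrices $\Sigma_1,\Sigma_2$, respectively, and let $\varepsilon>0$. Let $$X_\varepsilon=\Sigma_1^{-1/2}\big(\Sigma_1^{1/2}\Sigma_2\Sigma_1^{1/2}+(\tfrac{\varepsilon}{4})^2 I_d\big)^{1/2}\Sigma_1^{-1/2}-\tfrac{\varepsilon}{4}\Sigma_1^{-1}.$$ Then $$\mathcal{W}^2_{2,\varepsilon}(P,Q)\ge\|\mu_1-\mu_2\|^2+\mathrm{Tr}(\Sigma_1)+\mathrm{Tr}(\Sigma_2)-2\,\mathrm{Tr}(\Sigma_1X_\varepsilon)-\tfrac{\varepsilon}{2}\log\Big((2\pi e)^{2d}\big(\tfrac{\varepsilon}{2}\big)^d\,|\Sigma_1X_\varepsilon|\Big),$$ with equality if and only if $P$ and $Q$ are Gaussian.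
   Context: For probabilities $P,Q$ on $\mathbb{R}^d$, $\Pi(P,Q)$ is the set of probabilities on $\mathbb{R}^d\times\mathbb{R}^d$ with marginals $P$ and $Q$. For a probability $\pi$ on $\mathbb{R}^d\times\mathbb{R}^d$, $H(\pi)=\int r(x,y)\log r(x,y)\,dx\,dy$ if $\pi$ has a Lebesgue density $r$, and $H(\pi)=+\infty$ otherwise. For $\varepsilon>0$, $\mathcal{W}^2_{2,\varepsilon}(P,Q)=\min_{\pi\in\Pi(P,Q)}\big[\int\|x-y\|^2\,d\pi(x,y)+\varepsilon H(\pi)\big]$. $|A|$ denotes the determinant; $A^{1/2}$ is the symmetric positive definite square root; in $(2\pi e)$, $\pi$ is the number $3.14\ldots$. *)

theory Defs
  imports "HOL-Probability.Probability"
begin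

definition pos_def_mat :: "real^'n^'n \<Rightarrow> bool" where
  "pos_def_mat A \<longleftrightarrow> transpose A = A \<and> (\<forall>x. x \<noteq> 0 \<longrightarrow> x \<bullet> (A *v x) > 0)"

definition psd_mat :: "real^'n^'n \<Rightarrow> bool" where
  "psd_mat A \<longleftrightarrow> transpose A = A \<and> (\<forall>x. 0 \<le> x \<bullet> (A *v x))"

definition msqrt :: "real^'n^'n \<Rightarrow> real^'n^'n" where
  "msqrt A = (THE B. psd_mat B \<and> B ** B = A)"

definition mean_vec :: "(real^'n) measure \<Rightarrow> real^'n" where
  "mean_vec P = integral\<^sup>L P (\<lambda>x. x)"

definition cov_mat :: "(real^'n) measure \<Rightarrow> real^'n^'n" where
  "cov_mat P = (\<chi> i j. integral\<^sup>L P (\<lambda>x. (x$i - mean_vec P $ i) * (x$j - mean_vec P $ j)))"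

definition couplings :: "(real^'n) measure \<Rightarrow> (real^'n) measure \<Rightarrow> ((real^'n) \<times> (real^'n)) measure set" where
  "couplings P Q = {\<pi>. prob_space \<pi> \<and> sets \<pi> = sets borel \<and>
      distr \<pi> borel fst = P \<and> distr \<pi> borel snd = Q}"

definition has_leb_density :: "('a::euclidean_space) measure \<Rightarrow> ('a \<Rightarrow> real) \<Rightarrow> bool" where
  "has_leb_density \<pi> r \<longleftrightarrow> r \<in> borel_measurable lborel \<and> (\<forall>z. 0 \<le> r z) \<and>
      \<pi> = density lborel (\<lambda>z. ennreal (r z))"

definition entropy_H :: "('a::euclidean_space) measure \<Rightarrow> ereal" where
  "entropy_H \<pi> = (if \<exists>r. has_leb_density \<pi> r then
      (let r = (SOME r. has_leb_density \<pi> r) in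
        enn2ereal (\<integral>\<^sup>+ z. ennreal (r z * ln (r z)) \<partial>lborel)
        - enn2ereal (\<integral>\<^sup>+ z. ennreal (- (r z * ln (r z))) \<partial>lborel))
    else \<infinity>)"

definition entropic_W2 :: "real \<Rightarrow> (real^'n) measure \<Rightarrow> (real^'n) measure \<Rightarrow> ereal" where
  "entropic_W2 \<epsilon> P Q = (INF \<pi>\<in>couplings P Q.
      enn2ereal (\<integral>\<^sup>+ z. ennreal ((norm (fst z - snd z))\<^sup>2) \<partial>\<pi>) + ereal \<epsilon> * entropy_H \<pi>)"

definition gaussian_pdf :: "real^'n \<Rightarrow> real^'n^'n \<Rightarrow> real^'n \<Rightarrow> real" where
  "gaussian_pdf m S x = (2 * pi) powr (- real CARD('n) / 2) * det S powr (-1/2) *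
      exp (- (1/2) * ((x - m) \<bullet> (matrix_inv S *v (x - m))))"

definition is_gaussian :: "(real^'n) measure \<Rightarrow> bool" where
  "is_gaussian P \<longleftrightarrow> (\<exists>m S. pos_def_mat S \<and> P = density lborel (\<lambda>x. ennreal (gaussian_pdf m S x)))"

end

theory Submission
  imports Defs
begin

text \<open>Let \<open>S1\<close>, \<open>S2\<close> be the covariance matrices. The matrix \<open>X\<close> is positive definite and solves
  \<open>X S1 X + (\<epsilon>/2) X = S2\<close>. Let \<open>\<rho>\<close> be the Gaussian measure with first marginal
  \<open>N(m1, S1)\<close> and conditional law \<open>N(m2 + X (x - m1), (\<epsilon>/2) X)\<close> of \<open>y\<close> given \<open>x\<close>; the equation
  makes its second marginal \<open>N(m2, S2)\<close>. The precision matrix of \<open>\<rho>\<close> has off-diagonal block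
  \<open>-(2/\<epsilon>) I\<close>, so in \<open>|x - y|\<^sup>2 + \<epsilon> ln \<rho>(x, y)\<close> the mixed terms cancel and what remains is a
  quadratic function of \<open>x\<close> plus one of \<open>y\<close>. Its integral against a coupling depends only on the
  first two moments of the marginals, hence every coupling \<open>\<pi>\<close> with a density satisfies
  \<open>cost \<pi> = bound + \<epsilon> KL(\<pi> | \<rho>)\<close>. Both claims follow from \<open>KL \<ge> 0\<close> and from the fact that
  \<open>KL \<rightarrow> 0\<close> forces convergence to \<open>\<rho>\<close> in total variation.\<close>

subsection \<open>Spectral theorem and positive definite matrices\<close>

text \<open>The equation for \<open>X\<close> comes from the expected shape exp((f(x) + g(y) - |x -
  y|^2)/\<epsilon>) of an optimal density. For a Gaussian this forces the off-diagonal precision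
  block -(2/\<epsilon>) I. With regression matrix \<open>X\<close> and conditional covariance
  \<open>C\<close> that block is -(inverse of \<open>C\<close>) \<open>X\<close>, so
  \<open>C\<close> = (\<epsilon>/2) \<open>X\<close>, and the covariance \<open>X S1 X + C\<close>
  of the second coordinate has to be \<open>S2\<close>. In general \<rho> is not a coupling of
  \<open>P\<close> and \<open>Q\<close>: its marginals are the Gaussians with the same first two
  moments. It is a coupling exactly in the Gaussian case, and this is what the equality statement
  detects. The delicate point is the entropy, a difference of two integrals that might both be
  infinite. The integrand is therefore split into a pointwise nonnegative relative entropy density
  and a remainder whose integrability follows from the finite second moments.\<close>

lemma quadratic_nonneg_imp_linear_zero:
  fixes a b :: real
  assumes "\<And>t. 0 \<le> 2 * t * a + t\<^sup>2 * b"
  shows "a = 0"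
proof (rule ccontr)
  assume "a \<noteq> 0"
  \<comment> \<open>At \<open>t = - a / c\<close> the quadratic equals
    \<open>a\<^sup>2 / c\<^sup>2 * (b - 2 * c)\<close>; any positive \<open>c\<close> above
    \<open>b / 2\<close> makes it negative.\<close>
  define c where "c = \<bar>b\<bar> + 1"
  have "c > 0" "b < 2 * c" unfolding c_def by auto
  have "2 * (- a / c) * a + (- a / c)\<^sup>2 * b = (a\<^sup>2 / c\<^sup>2) * (b - 2 * c)"
    using \<open>c > 0\<close> by (simp add: field_simps power2_eq_square)
  also have "\<dots> < 0"
    using \<open>a \<noteq> 0\<close> \<open>c > 0\<close> \<open>b < 2 * c\<close> by (intro mult_pos_neg) auto
  finally show False using assms[of "- a / c"] by simp
qed

text \<open>The maximiser of the Rayleigh quotient over an invariant subspace is an eigenvector.\<close>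
lemma selfadjoint_eigenvector_exists:
  fixes f :: "'a::euclidean_space \<Rightarrow> 'a"
  assumes "linear f" and sym: "\<And>x y. f x \<bullet> y = x \<bullet> f y"
    and "subspace V" "f ` V \<subseteq> V" "V \<noteq> {0}"
  obtains v c where "v \<in> V" "norm v = 1" "f v = c *\<^sub>R v"
proof -
  interpret linear f by fact
  obtain w where w: "w \<in> V" "w \<noteq> 0" using \<open>V \<noteq> {0}\<close> \<open>subspace V\<close> subspace_0 by blast
  let ?S = "V \<inter> sphere 0 1"
  have "compact ?S" by (intro closed_Int_compact closed_subspace \<open>subspace V\<close>) auto
  moreover have "(1 / norm w) *\<^sub>R w \<in> ?S"
    using w \<open>subspace V\<close> by (auto simp: subspace_scale)
  moreover have "continuous_on ?S (\<lambda>x. x \<bullet> f x)"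
    by (intro continuous_intros linear_continuous_on) (use \<open>linear f\<close> linear_conv_bounded_linear in blast)
  ultimately obtain v where v: "v \<in> V" "norm v = 1"
    and max: "\<And>y. y \<in> V \<Longrightarrow> norm y = 1 \<Longrightarrow> y \<bullet> f y \<le> v \<bullet> f v"
    using continuous_attains_sup[of ?S "\<lambda>x. x \<bullet> f x"] by (metis IntE IntI emptyE mem_sphere_0)
  define c where "c = v \<bullet> f v"
  \<comment> \<open>Maximality on the unit sphere, made homogeneous so that unnormalised
    perturbations of \<open>v\<close> can be inserted.\<close>
  have form: "0 \<le> c * (y \<bullet> y) - y \<bullet> f y" if "y \<in> V" for y
  proof (cases "y = 0")
    case False
    let ?u = "(1 / norm y) *\<^sub>R y"
    have "?u \<bullet> f ?u \<le> c"
      unfolding c_def by (rule max) (use that False \<open>subspace V\<close> in \<open>auto simp: subspace_scale\<close>)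
    moreover have "?u \<bullet> f ?u = (y \<bullet> f y) / (y \<bullet> y)"
      by (simp add: scale power2_norm_eq_inner[symmetric] power2_eq_square)
    ultimately have "(y \<bullet> f y) / (y \<bullet> y) \<le> c" by simp
    then show ?thesis using False by (simp add: divide_le_eq)
  qed (simp add: zero)
  \<comment> \<open>First variation: the nonnegative form vanishes at \<open>v\<close>, so its
    linear term in every direction \<open>w\<close> of \<open>V\<close> must vanish.\<close>
  have orth: "w \<bullet> (c *\<^sub>R v - f v) = 0" if "w \<in> V" for w
  proof (rule quadratic_nonneg_imp_linear_zero)
    fix t
    have "0 \<le> c * ((v + t *\<^sub>R w) \<bullet> (v + t *\<^sub>R w)) - (v + t *\<^sub>R w) \<bullet> f (v + t *\<^sub>R w)"
      by (rule form) (intro subspace_add subspace_scale \<open>subspace V\<close> v that)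
    also have "\<dots> = 2 * t * (w \<bullet> (c *\<^sub>R v - f v)) + t\<^sup>2 * (c * (w \<bullet> w) - w \<bullet> f w)
        + (c * (v \<bullet> v) - v \<bullet> f v)"
      using sym[of v w]
      by (simp add: add scale inner_add_left inner_add_right inner_diff_right
          algebra_simps power2_eq_square inner_commute)
    also have "c * (v \<bullet> v) - v \<bullet> f v = 0"
      using v by (simp add: c_def dot_square_norm)
    finally show "0 \<le> 2 * t * (w \<bullet> (c *\<^sub>R v - f v)) + t\<^sup>2 * (c * (w \<bullet> w) - w \<bullet> f w)" by simp
  qed
  have "c *\<^sub>R v - f v \<in> V"
    using v \<open>f ` V \<subseteq> V\<close> \<open>subspace V\<close> by (intro subspace_diff subspace_scale) auto
  then have "c *\<^sub>R v - f v = 0" using orth inner_eq_zero_iff by blast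
  then have "f v = c *\<^sub>R v" by simp
  then show thesis using that v by blast
qed

text \<open>Induction on the dimension: self-adjointness makes the orthogonal complement of an
  eigenvector invariant. Working with invariant subspaces instead of the whole space lets the
  induction pass to that complement.\<close>

lemma selfadjoint_orthonormal_eigenbasis:
  fixes f :: "'a::euclidean_space \<Rightarrow> 'a"
  assumes "linear f" and sym: "\<And>x y. f x \<bullet> y = x \<bullet> f y"
    and "subspace V" "f ` V \<subseteq> V"
  shows "\<exists>B. B \<subseteq> V \<and> pairwise orthogonal B \<and> (\<forall>b\<in>B. norm b = 1) \<and> V \<subseteq> span B
            \<and> (\<forall>b\<in>B. \<exists>c. f b = c *\<^sub>R b)"
  using assms(3,4)
proof (induction "dim V" arbitrary: V rule: less_induct)
  case less
  show ?case
  proof (cases "V = {0}")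
    case True
    then show ?thesis by (intro exI[of _ "{}"]) auto
  next
    case False
    obtain v c where v: "v \<in> V" "norm v = 1" "f v = c *\<^sub>R v"
      using selfadjoint_eigenvector_exists[OF assms(1,2) less.prems False] .
    let ?W = "V \<inter> {x. v \<bullet> x = 0}"
    have sub: "subspace ?W"
      by (intro subspace_inter less.prems subspace_hyperplane)
    have inv: "f ` ?W \<subseteq> ?W"
    proof (intro image_subsetI)
      fix x assume x: "x \<in> V \<inter> {x. v \<bullet> x = 0}"
      then show "f x \<in> V \<inter> {x. v \<bullet> x = 0}"
        using less.prems(2) sym[of v x, unfolded v(3), symmetric] by (simp add: image_subset_iff)
    qed
    have "v \<noteq> 0" using v(2) by auto
    then have "v \<notin> ?W" by simp
    then have "?W \<subset> V" using v(1) by blast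
    then have "dim ?W < dim V"
      using sub less.prems(1) by (intro dim_psubset) (simp add: span_eq_iff[THEN iffD2])
    from less.hyps[OF this sub inv] obtain B where B: "B \<subseteq> ?W" "pairwise orthogonal B"
      "\<forall>b\<in>B. norm b = 1" "?W \<subseteq> span B" "\<forall>b\<in>B. \<exists>c. f b = c *\<^sub>R b" by (elim exE conjE)
    have "V \<subseteq> span (insert v B)"
    proof
      fix x assume "x \<in> V"
      have "x - (v \<bullet> x) *\<^sub>R v \<in> ?W"
        using \<open>x \<in> V\<close> v less.prems(1)
        by (simp add: inner_diff_right dot_square_norm subspace_diff subspace_scale)
      then have "x - (v \<bullet> x) *\<^sub>R v \<in> span B" using B by blast
      then show "x \<in> span (insert v B)" unfolding span_insert by blast
    qed
    moreover have "pairwise orthogonal (insert v B)"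
      using B(1,2) unfolding pairwise_insert by (auto simp: orthogonal_def inner_commute)
    ultimately show ?thesis
      using B(1,3,5) v by (intro exI[of _ "insert v B"] conjI) blast+
  qed
qed

section \<open>Orthogonal diagonalisation of symmetric matrices\<close>

definition diag_mat :: "('n \<Rightarrow> real) \<Rightarrow> real^'n^'n" where
  "diag_mat d = (\<chi> i j. if i = j then d i else 0)"

lemma diag_mat_mult: "diag_mat d ** diag_mat e = diag_mat (\<lambda>i. d i * e i)"
  by (simp add: diag_mat_def matrix_matrix_mult_def vec_eq_iff if_distrib [where f="\<lambda>x. x * _"]
      cong: if_cong)

lemma diag_mat_one: "diag_mat (\<lambda>_. 1) = mat 1"
  by (simp add: diag_mat_def mat_def)

lemma transpose_diag_mat [simp]: "transpose (diag_mat d) = diag_mat d"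
  by (simp add: diag_mat_def transpose_def vec_eq_iff)

lemma det_diag_mat: "det (diag_mat d) = (\<Prod>i\<in>UNIV. d i)"
  by (subst det_diagonal) (simp_all add: diag_mat_def)

lemma diag_mat_vec: "(diag_mat d *v x) $ i = d i * x $ i"
  by (simp add: diag_mat_def matrix_vector_mult_def if_distrib [where f="\<lambda>x. x * _"] cong: if_cong)

lemma symmetric_inner:
  fixes A :: "real^'n^'n"
  assumes "transpose A = A"
  shows "(A *v x) \<bullet> y = x \<bullet> (A *v y)"
  by (metis assms dot_lmul_matrix vector_transpose_matrix)

theorem spectral_theorem:
  fixes A :: "real^'n^'n"
  assumes "transpose A = A"
  obtains U d where "orthogonal_matrix U" "A = U ** diag_mat d ** transpose U"
proof -
  obtain B where B: "pairwise orthogonal B"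
      "\<forall>b\<in>B. norm b = 1" "UNIV \<subseteq> span B" "\<forall>b\<in>B. \<exists>c. A *v b = c *\<^sub>R b"
    using selfadjoint_orthonormal_eigenbasis[of "(*v) A" UNIV, OF matrix_vector_mul_linear
        symmetric_inner[OF assms]] by auto
  have "0 \<notin> B" using B(2) by force
  then have ind: "independent B" by (rule pairwise_orthogonal_independent[OF B(1)])
  have "card B = CARD('n)"
    using basis_card_eq_dim[OF _ B(3) ind] by (simp add: dim_UNIV)
  moreover have "finite B" using ind independent_imp_finite by blast
  ultimately
  obtain e where e: "bij_betw e (UNIV :: 'n set) B"
    by (metis finite_class.finite_UNIV finite_same_card_bij)
  then have eB: "e i \<in> B" for i by (auto simp: bij_betw_def)
  have "\<forall>i. \<exists>c. A *v e i = c *\<^sub>R e i" using B(4) eB by blast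
  then obtain d where d: "\<And>i. A *v e i = d i *\<^sub>R e i" by metis
  \<comment> \<open>The eigenvectors become the columns of \<open>U\<close>, hence the transpose of
    the matrix that lists them as rows.\<close>
  define U where "U = transpose (\<chi> i. e i)"
  have inner: "e i \<bullet> e j = (if i = j then 1 else 0)" for i j
  proof (cases "i = j")
    case False
    then have "e i \<noteq> e j" using e by (auto simp: bij_betw_def inj_on_def)
    then show ?thesis using B(1) eB False by (auto simp: pairwise_def orthogonal_def)
  qed (use B(2) eB in \<open>simp add: dot_square_norm\<close>)
  have "transpose U ** U = mat 1"
    using inner by (simp add: U_def matrix_matrix_mult_def vec_eq_iff transpose_def mat_def inner_vec_def)
  then have U: "orthogonal_matrix U" by (simp add: orthogonal_matrix)
  have "A ** U = U ** diag_mat d"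
  proof -
    have "(A ** U) $ j $ i = (U ** diag_mat d) $ j $ i" for i j
    proof -
      have "(A ** U) $ j $ i = (A *v e i) $ j"
        by (simp add: U_def transpose_def matrix_matrix_mult_def matrix_vector_mult_def)
      also have "\<dots> = d i * e i $ j" by (simp add: d)
      also have "\<dots> = (U ** diag_mat d) $ j $ i"
        by (simp add: U_def transpose_def matrix_matrix_mult_def diag_mat_def
            if_distrib [where f="\<lambda>x. _ * x"] cong: if_cong)
      finally show ?thesis .
    qed
    then show ?thesis by (simp add: vec_eq_iff)
  qed
  then have "A ** (U ** transpose U) = U ** diag_mat d ** transpose U"
    by (simp add: matrix_mul_assoc)
  then have "A = U ** diag_mat d ** transpose U"
    using U by (simp add: orthogonal_matrix_def)
  with U that show thesis by blast
qed

lemma quadratic_form_congruence: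
  fixes A :: "real^'n^'n"
  shows "x \<bullet> ((transpose C ** A ** C) *v x) = (C *v x) \<bullet> (A *v (C *v x))"
proof -
  have "x \<bullet> (transpose C *v w) = (C *v x) \<bullet> w" for w
    by (metis dot_lmul_matrix vector_transpose_matrix)
  then show ?thesis by (simp only: matrix_vector_mul_assoc[symmetric])
qed

lemma quadratic_form_diag:
  "x \<bullet> ((U ** diag_mat d ** transpose U) *v x) = (\<Sum>i\<in>UNIV. d i * ((transpose U *v x) $ i)\<^sup>2)"
  using quadratic_form_congruence[of x "transpose U" "diag_mat d"]
  by (simp add: inner_vec_def diag_mat_vec power2_eq_square mult_ac)

lemma transpose_sandwich_diag [simp]:
  "transpose (U ** diag_mat d ** transpose U) = U ** diag_mat d ** transpose U"
  by (simp add: matrix_transpose_mul matrix_mul_assoc)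

lemma orthogonal_matrix_transpose_vec_nonzero:
  fixes U :: "real^'n^'n"
  assumes "orthogonal_matrix U" "x \<noteq> 0"
  shows "transpose U *v x \<noteq> 0"
proof
  assume "transpose U *v x = 0"
  then have "U *v (transpose U *v x) = 0" by simp
  then show False
    using assms by (simp add: matrix_vector_mul_assoc orthogonal_matrix_def del: transpose_matrix_vector)
qed

text \<open>Column \<open>i\<close> of \<open>U\<close> is an eigenvector for \<open>d i\<close>;
  this carries statements about arbitrary eigenvectors over to the entries of
  \<open>d\<close>.\<close>

lemma sandwich_column:
  fixes U :: "real^'n^'n"
  assumes "orthogonal_matrix U"
  shows "(U ** diag_mat d ** transpose U) *v (U *v axis i 1) = d i *\<^sub>R (U *v axis i 1)"
    and "U *v axis i 1 \<noteq> 0"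
proof -
  have *: "transpose U *v (U *v x) = x" for x
    using assms by (simp add: matrix_vector_mul_assoc orthogonal_matrix_def del: transpose_matrix_vector)
  have "diag_mat d *v axis i 1 = d i *\<^sub>R axis i 1"
    by (simp add: vec_eq_iff diag_mat_vec axis_def)
  then show "(U ** diag_mat d ** transpose U) *v (U *v axis i 1) = d i *\<^sub>R (U *v axis i 1)"
    by (simp add: matrix_vector_mul_assoc[symmetric] * matrix_vector_mult_scaleR del: transpose_matrix_vector)
  show "U *v axis i 1 \<noteq> 0"
    using *[of "axis i 1"] by (metis axis_eq_0_iff matrix_vector_mult_0_right zero_neq_one)
qed

section \<open>Positive definiteness through eigenvalues\<close>

lemma pos_def_mat_iff_diag:
  fixes U :: "real^'n^'n"
  assumes U: "orthogonal_matrix U"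
  shows "pos_def_mat (U ** diag_mat d ** transpose U) \<longleftrightarrow> (\<forall>i. 0 < d i)"
proof
  assume *: "pos_def_mat (U ** diag_mat d ** transpose U)"
  show "\<forall>i. 0 < d i"
  proof
    fix i
    let ?v = "U *v axis i 1"
    have "0 < ?v \<bullet> (d i *\<^sub>R ?v)"
      using * sandwich_column(1)[OF U, where d=d and i=i] sandwich_column(2)[OF U, where i=i] by (metis pos_def_mat_def)
    then show "0 < d i"
      by (metis inner_ge_zero inner_scaleR_right mult_nonpos_nonneg not_less)
  qed
next
  assume d: "\<forall>i. 0 < d i"
  show "pos_def_mat (U ** diag_mat d ** transpose U)"
    unfolding pos_def_mat_def
  proof (intro conjI allI impI)
    fix x :: "real^'n" assume "x \<noteq> 0"
    then obtain i where i: "(transpose U *v x) $ i \<noteq> 0"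
      using orthogonal_matrix_transpose_vec_nonzero[OF U] by (metis vec_eq_iff zero_index)
    then show "0 < x \<bullet> ((U ** diag_mat d ** transpose U) *v x)"
      unfolding quadratic_form_diag using d
      by (intro sum_pos2[of _ i]) (simp_all add: less_imp_le del: transpose_matrix_vector)
  qed simp
qed

lemma pos_def_spectral:
  assumes "pos_def_mat A"
  obtains U d where "orthogonal_matrix U" "A = U ** diag_mat d ** transpose U" "\<And>i. 0 < d i"
  using assms spectral_theorem[of A] pos_def_mat_iff_diag by (metis pos_def_mat_def)

text \<open>A criterion that hides the diagonalisation: a later proof can argue with a single
  eigenvector at a time.\<close>

lemma pos_def_if_eigenvalues_pos:
  fixes A :: "real^'n^'n"
  assumes "transpose A = A" and ev: "\<And>v c. v \<noteq> 0 \<Longrightarrow> A *v v = c *\<^sub>R v \<Longrightarrow> 0 < c"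
  shows "pos_def_mat A"
proof -
  obtain U d where U: "orthogonal_matrix U" "A = U ** diag_mat d ** transpose U"
    using spectral_theorem assms(1) .
  then have "0 < d i" for i using sandwich_column(1)[OF U(1), where d=d and i=i] sandwich_column(2)[OF U(1), where i=i] ev by metis
  then show ?thesis using U pos_def_mat_iff_diag by metis
qed

lemma symmetric_zero_if_eigenvalues_zero:
  fixes A :: "real^'n^'n"
  assumes "transpose A = A" and ev: "\<And>v c. v \<noteq> 0 \<Longrightarrow> A *v v = c *\<^sub>R v \<Longrightarrow> c = 0"
  shows "A = 0"
proof -
  obtain U d where U: "orthogonal_matrix U" "A = U ** diag_mat d ** transpose U"
    using spectral_theorem assms(1) .
  then have "d i = 0" for i using sandwich_column(1)[OF U(1), where d=d and i=i] sandwich_column(2)[OF U(1), where i=i] ev by metis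
  then have "d = (\<lambda>_. 0)" by blast
  moreover have "diag_mat (\<lambda>_. 0) = (0 :: real^'n^'n)" by (simp add: diag_mat_def vec_eq_iff)
  ultimately show ?thesis using U by simp
qed

lemma det_orthogonal_sandwich:
  fixes U :: "real^'n^'n"
  assumes "orthogonal_matrix U"
  shows "det (U ** diag_mat d ** transpose U) = (\<Prod>i\<in>UNIV. d i)"
proof -
  have "det U * det (transpose U) = 1"
    using assms by (metis det_I det_mul orthogonal_matrix_def)
  then show ?thesis by (simp add: det_mul det_diag_mat)
qed

lemma pos_def_det_pos:
  assumes "pos_def_mat A"
  shows "0 < det A"
  using assms by (rule pos_def_spectral) (simp add: det_orthogonal_sandwich prod_pos)

section \<open>Matrix inverses and square roots\<close>

lemma matrix_inv_inverse:
  fixes A :: "'a::semiring_1^'n^'m"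
  assumes "invertible A"
  shows "A ** matrix_inv A = mat 1" "matrix_inv A ** A = mat 1"
  using someI_ex[OF assms[unfolded invertible_def]] by (auto simp: matrix_inv_def)

lemma matrix_inv_eqI:
  fixes A :: "'a::field^'n^'n"
  assumes "A ** B = mat 1"
  shows "matrix_inv A = B"
proof -
  have "B ** A = mat 1" using assms by (simp add: matrix_left_right_inverse)
  then have "matrix_inv A = B ** (A ** matrix_inv A)" by (simp add: matrix_mul_assoc)
  also have "\<dots> = B"
    using matrix_inv_inverse(1)[of A] \<open>B ** A = mat 1\<close> assms unfolding invertible_def
    by (metis matrix_mul_rid)
  finally show ?thesis .
qed

lemma pos_def_invertible:
  fixes A :: "real^'n^'n"
  assumes "pos_def_mat A"
  shows "invertible A"
  using pos_def_det_pos[OF assms] by (simp add: invertible_det_nz)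

lemmas pos_def_matrix_inv = matrix_inv_inverse[OF pos_def_invertible]

lemma pos_def_congruence:
  fixes A C :: "real^'n^'n"
  assumes "pos_def_mat A" "invertible C"
  shows "pos_def_mat (transpose C ** A ** C)"
  unfolding pos_def_mat_def
proof (intro conjI allI impI)
  show "transpose (transpose C ** A ** C) = transpose C ** A ** C"
    using assms by (simp add: pos_def_mat_def matrix_transpose_mul matrix_mul_assoc)
  fix x :: "real^'n" assume "x \<noteq> 0"
  then have "C *v x \<noteq> 0"
    using \<open>invertible C\<close> by (metis invertible_left_inverse matrix_left_invertible_ker)
  then show "0 < x \<bullet> ((transpose C ** A ** C) *v x)"
    using assms by (simp add: quadratic_form_congruence pos_def_mat_def)
qed

lemma pos_def_inverse:
  fixes A :: "real^'n^'n"
  assumes "pos_def_mat A"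
  shows "pos_def_mat (matrix_inv A)"
proof -
  obtain U d where U: "orthogonal_matrix U" "A = U ** diag_mat d ** transpose U" "\<And>i. 0 < d i"
    using pos_def_spectral[OF assms] by metis
  have 1: "U ** transpose U = mat 1" "transpose U ** U = mat 1"
    using U(1) by (auto simp: orthogonal_matrix_def)
  have "A ** (U ** diag_mat (\<lambda>i. inverse (d i)) ** transpose U)
      = U ** diag_mat d ** (transpose U ** U) ** diag_mat (\<lambda>i. inverse (d i)) ** transpose U"
    by (simp add: U(2) matrix_mul_assoc)
  also have "\<dots> = U ** (diag_mat d ** diag_mat (\<lambda>i. inverse (d i))) ** transpose U"
    by (simp add: 1 matrix_mul_assoc)
  also have "\<dots> = mat 1"
    using U(3) by (simp add: diag_mat_mult 1 diag_mat_one less_imp_neq[THEN not_sym])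
  finally have "matrix_inv A = U ** diag_mat (\<lambda>i. inverse (d i)) ** transpose U"
    by (rule matrix_inv_eqI)
  then show ?thesis using U by (simp add: pos_def_mat_iff_diag)
qed

lemma pos_def_add:
  assumes "pos_def_mat A" "pos_def_mat B"
  shows "pos_def_mat (A + B)"
  using assms unfolding pos_def_mat_def
  by (auto simp: transpose_def vec_eq_iff matrix_vector_mult_add_rdistrib inner_add_right add_pos_pos)

lemma pos_def_scaleR:
  assumes "pos_def_mat A" "0 < c"
  shows "pos_def_mat (c *\<^sub>R A)"
  using assms unfolding pos_def_mat_def
  by (auto simp: transpose_def vec_eq_iff scaleR_matrix_vector_assoc[symmetric])

text \<open>If \<open>B\<^sup>2 = C\<^sup>2\<close> and \<open>D = B - C\<close>, then \<open>B D + D C = 0\<close>; testing this on an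
  eigenvector of \<open>D\<close> shows that all eigenvalues of \<open>D\<close> vanish.\<close>
lemma psd_sqrt_unique:
  fixes B C :: "real^'n^'n"
  assumes B: "psd_mat B" and C: "psd_mat C" and eq: "B ** B = C ** C"
  shows "B = C"
proof -
  have sym: "transpose B = B" "transpose C = C" using B C by (auto simp: psd_mat_def)
  have "B - C = 0"
  proof (rule symmetric_zero_if_eigenvalues_zero)
    show "transpose (B - C) = B - C" using sym by (simp add: transpose_def vec_eq_iff)
    fix v and c :: real assume "v \<noteq> 0" and v: "(B - C) *v v = c *\<^sub>R v"
    then have D: "B *v v = C *v v + c *\<^sub>R v"
      by (simp add: matrix_vector_mult_diff_rdistrib algebra_simps)
    have "(B *v v) \<bullet> (B *v v) = (C *v v) \<bullet> (C *v v)"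
      by (simp add: symmetric_inner[OF sym(1)] symmetric_inner[OF sym(2)] matrix_vector_mul_assoc eq)
    then have "c * (v \<bullet> (B *v v) + v \<bullet> (C *v v)) = 0"
      unfolding D by (simp add: algebra_simps inner_commute)
    moreover have "c * (v \<bullet> v) = v \<bullet> (B *v v) - v \<bullet> (C *v v)"
      unfolding D by (simp add: inner_add_right)
    moreover have "0 \<le> v \<bullet> (B *v v)" "0 \<le> v \<bullet> (C *v v)"
      using B C by (auto simp: psd_mat_def)
    \<comment> \<open>If \<open>c\<close> is nonzero, the sum of the two nonnegative forms is zero,
      so each vanishes and so does their difference \<open>c * (v \<bullet> v)\<close>.\<close>
    ultimately have "c = 0 \<or> c * (v \<bullet> v) = 0"
      by (smt (verit) mult_eq_0_iff)
    then show "c = 0" using \<open>v \<noteq> 0\<close> by simp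
  qed
  then show ?thesis by simp
qed

lemma pos_def_imp_psd: "pos_def_mat A \<Longrightarrow> psd_mat A"
  by (metis inner_zero_left less_imp_le order_refl pos_def_mat_def psd_mat_def)

text \<open>\<open>msqrt\<close> is a definite description, so existence and uniqueness are both
  required: the root is built in an eigenbasis of \<open>A\<close>, and
  \<open>psd_sqrt_unique\<close> identifies it.\<close>

lemma pos_def_msqrt:
  assumes "pos_def_mat A"
  shows "pos_def_mat (msqrt A)" "msqrt A ** msqrt A = A"
proof -
  obtain U d where U: "orthogonal_matrix U" "A = U ** diag_mat d ** transpose U" "\<And>i. 0 < d i"
    using pos_def_spectral[OF assms] by metis
  let ?R = "U ** diag_mat (\<lambda>i. sqrt (d i)) ** transpose U"
  have "?R ** ?R = U ** diag_mat (\<lambda>i. sqrt (d i)) ** (transpose U ** U)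
      ** diag_mat (\<lambda>i. sqrt (d i)) ** transpose U"
    by (simp add: matrix_mul_assoc)
  also have "\<dots> = U ** (diag_mat (\<lambda>i. sqrt (d i)) ** diag_mat (\<lambda>i. sqrt (d i))) ** transpose U"
    using U(1) by (simp add: matrix_mul_assoc orthogonal_matrix_def)
  also have "\<dots> = A"
    using U(2,3) by (simp add: diag_mat_mult less_imp_le)
  finally have R: "?R ** ?R = A" .
  have pd: "pos_def_mat ?R" using U by (simp add: pos_def_mat_iff_diag)
  have "msqrt A = ?R"
    unfolding msqrt_def
  proof (rule the_equality)
    show "psd_mat ?R \<and> ?R ** ?R = A" using R pos_def_imp_psd[OF pd] by blast
    fix B assume "psd_mat B \<and> B ** B = A"
    then show "B = ?R" using psd_sqrt_unique[of B ?R] R pos_def_imp_psd[OF pd] by simp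
  qed
  with R pd show "pos_def_mat (msqrt A)" "msqrt A ** msqrt A = A" by auto
qed

subsection \<open>The matrix equation for the transport matrix\<close>

lemma matrix_add_rdistrib_real: "((A::real^'n^'m) + B) ** (C :: real^'p^'n) = A ** C + B ** C"
  by (simp add: matrix_matrix_mult_def vec_eq_iff algebra_simps sum.distrib)

lemma matrix_diff_ldistrib: "(A::real^'n^'m) ** ((B :: real^'p^'n) - C) = A ** B - A ** C"
  by (simp add: matrix_matrix_mult_def vec_eq_iff algebra_simps sum_subtractf)

lemma matrix_diff_rdistrib: "((A::real^'n^'m) - B) ** (C :: real^'p^'n) = A ** C - B ** C"
  by (simp add: matrix_matrix_mult_def vec_eq_iff algebra_simps sum_subtractf)

lemma matrix_mul_scaleR_left: "(k *\<^sub>R (A::real^'n^'m)) ** (B :: real^'p^'n) = k *\<^sub>R (A ** B)"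
  by (simp add: matrix_matrix_mult_def vec_eq_iff sum_distrib_left mult_ac)

lemma matrix_mul_scaleR_right: "(A::real^'n^'m) ** (k *\<^sub>R (B :: real^'p^'n)) = k *\<^sub>R (A ** B)"
  by (simp add: matrix_matrix_mult_def vec_eq_iff sum_distrib_left mult_ac)

lemmas matrix_ring_simps = matrix_add_ldistrib matrix_add_rdistrib_real matrix_diff_ldistrib
  matrix_diff_rdistrib matrix_mul_scaleR_left matrix_mul_scaleR_right matrix_mul_assoc

lemma mat_eq_scaleR: "(mat k :: real^'n^'n) = k *\<^sub>R mat 1"
  by (simp add: mat_def vec_eq_iff)

lemma det_scaleR: "det (k *\<^sub>R (A :: real^'n^'n)) = k ^ CARD('n) * det A"
proof -
  have "k *\<^sub>R A = mat k ** A"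
    by (subst mat_eq_scaleR) (simp add: matrix_mul_scaleR_left)
  then show ?thesis by (simp add: det_mul matrix_scaleR[symmetric])
qed

lemma trace_scaleR: "trace (k *\<^sub>R (A :: real^'n^'n)) = k * trace A"
  by (simp add: trace_def sum_distrib_left)

lemma pos_def_symmetric: "pos_def_mat A \<Longrightarrow> transpose A = A"
  by (simp add: pos_def_mat_def)

lemma pos_def_mat_1: "pos_def_mat (mat 1)"
  by (simp add: pos_def_mat_def)

lemma pos_def_sandwich:
  assumes "pos_def_mat A" "pos_def_mat R"
  shows "pos_def_mat (R ** A ** R)"
  using pos_def_congruence[OF assms(1) pos_def_invertible[OF assms(2)]] pos_def_symmetric[OF assms(2)]
  by simp

lemma matrix_inv_matrix_inv:
  assumes "pos_def_mat A"
  shows "matrix_inv (matrix_inv A) = A"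
  using pos_def_matrix_inv(2)[OF assms] by (rule matrix_inv_eqI)

lemma matrix_inv_scaleR:
  fixes A :: "real^'n^'n"
  assumes "invertible A" "k \<noteq> 0"
  shows "matrix_inv (k *\<^sub>R A) = (1 / k) *\<^sub>R matrix_inv A"
  by (rule matrix_inv_eqI)
    (use assms in \<open>simp add: matrix_mul_scaleR_left matrix_mul_scaleR_right matrix_inv_inverse\<close>)

text \<open>An eigenvector of the shifted root with eigenvalue \<open>b\<close> is one of the root
  with eigenvalue \<open>b + c\<close>. Squaring gives \<open>(b + c)\<^sup>2 > c\<^sup>2\<close>
  because \<open>L\<close> is positive definite, and \<open>b + c > 0\<close> then yields
  \<open>b > 0\<close>. This is the source of the positivity of \<open>X\<close>.\<close>

lemma pos_def_msqrt_shift: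
  fixes L :: "real^'n^'n"
  assumes L: "pos_def_mat L" and "0 < c"
  shows "pos_def_mat (msqrt (L + mat (c\<^sup>2)) - c *\<^sub>R mat 1)"
proof (rule pos_def_if_eigenvalues_pos)
  let ?M = "L + mat (c\<^sup>2)"
  let ?N = "msqrt ?M"
  have M: "pos_def_mat ?M"
    using \<open>0 < c\<close> by (subst mat_eq_scaleR) (intro pos_def_add pos_def_scaleR L pos_def_mat_1, simp)
  note N = pos_def_msqrt[OF M]
  show "transpose (?N - c *\<^sub>R mat 1) = ?N - c *\<^sub>R mat 1"
    using pos_def_symmetric[OF N(1)] by (simp add: transpose_def vec_eq_iff mat_def)
  fix v and b :: real
  assume v: "v \<noteq> 0" "(?N - c *\<^sub>R mat 1) *v v = b *\<^sub>R v"
  then have Nv: "?N *v v = (b + c) *\<^sub>R v"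
    by (simp add: matrix_vector_mult_diff_rdistrib scaleR_matrix_vector_assoc[symmetric] algebra_simps)
  have vv: "0 < v \<bullet> v" using v by simp
  have "0 < v \<bullet> (?N *v v)" using N(1) v by (simp add: pos_def_mat_def)
  then have bc: "0 < b + c" using vv by (simp add: Nv zero_less_mult_iff)
  have "?N *v (?N *v v) = L *v v + c\<^sup>2 *\<^sub>R v"
    by (simp add: matrix_vector_mul_assoc N(2) matrix_vector_mult_add_rdistrib)
      (subst mat_eq_scaleR, simp add: scaleR_matrix_vector_assoc[symmetric])
  moreover have "?N *v (?N *v v) = (b + c)\<^sup>2 *\<^sub>R v"
    unfolding Nv matrix_vector_mult_scaleR by (simp add: power2_eq_square)
  ultimately have "v \<bullet> ((b + c)\<^sup>2 *\<^sub>R v) = v \<bullet> (L *v v + c\<^sup>2 *\<^sub>R v)" by simp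
  then have "(b + c)\<^sup>2 * (v \<bullet> v) = v \<bullet> (L *v v) + c\<^sup>2 * (v \<bullet> v)"
    by (simp add: inner_add_right)
  moreover have "0 < v \<bullet> (L *v v)" using L v by (simp add: pos_def_mat_def)
  ultimately have "c\<^sup>2 * (v \<bullet> v) < (b + c)\<^sup>2 * (v \<bullet> v)" by simp
  then have "c\<^sup>2 < (b + c)\<^sup>2" using vv by simp
  then have "c < b + c" using bc by (intro power2_less_imp_less[of c "b + c"]) auto
  then show "0 < b" by simp
qed

text \<open>With \<open>R = msqrt S1\<close> and \<open>Y = R ** X ** R\<close> the equation for
  \<open>X\<close> becomes \<open>Y\<^sup>2\<close> + (\<epsilon>/2) \<open>Y\<close> =
  \<open>R S2 R\<close>. Completing the square gives (\<open>Y\<close> + (\<epsilon>/4) I)^2 =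
  \<open>R S2 R\<close> + (\<epsilon>/4)^2 I, which explains both occurrences of \<epsilon>/4 in the
  formula.\<close>

lemma entropic_transport_matrix:
  fixes S1 S2 X :: "real^'n^'n"
  assumes S: "pos_def_mat S1" "pos_def_mat S2" and "0 < \<epsilon>"
    and X: "X = matrix_inv (msqrt S1) **
             msqrt (msqrt S1 ** S2 ** msqrt S1 + mat ((\<epsilon>/4)\<^sup>2)) **
             matrix_inv (msqrt S1)
           - (\<epsilon>/4) *\<^sub>R matrix_inv S1"
  shows "pos_def_mat X" "X ** S1 ** X + (\<epsilon>/2) *\<^sub>R X = S2"
proof -
  define R where "R = msqrt S1"
  define Q where "Q = matrix_inv R"
  define L where "L = R ** S2 ** R"
  define M where "M = L + mat ((\<epsilon>/4)\<^sup>2)"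
  define N where "N = msqrt M"
  define c where "c = \<epsilon>/4"
  define Y where "Y = N - c *\<^sub>R mat 1"
  have R: "pos_def_mat R" "R ** R = S1" unfolding R_def using pos_def_msqrt[OF S(1)] .
  have QR: "Q ** R = mat 1" "R ** Q = mat 1" unfolding Q_def using pos_def_matrix_inv[OF R(1)] by auto
  have Q: "pos_def_mat Q" unfolding Q_def using pos_def_inverse[OF R(1)] .
  have "S1 ** (Q ** Q) = R ** (R ** Q) ** Q" by (simp add: R(2)[symmetric] matrix_mul_assoc)
  then have "matrix_inv S1 = Q ** Q" by (intro matrix_inv_eqI) (simp add: QR)
  then have XY: "X = Q ** Y ** Q"
    unfolding X Y_def N_def M_def L_def c_def
    by (simp add: matrix_ring_simps flip: R_def Q_def)
  have L: "pos_def_mat L" unfolding L_def using S(2) R(1) by (rule pos_def_sandwich)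
  have Y: "pos_def_mat Y"
    unfolding Y_def N_def M_def c_def using L \<open>0 < \<epsilon>\<close> by (intro pos_def_msqrt_shift) auto
  show "pos_def_mat X" unfolding XY using Y Q by (rule pos_def_sandwich)
  have M: "pos_def_mat M" unfolding M_def
    using \<open>0 < \<epsilon>\<close> by (subst mat_eq_scaleR) (intro pos_def_add pos_def_scaleR L pos_def_mat_1, simp)
  have NN: "N ** N = L + c\<^sup>2 *\<^sub>R mat 1"
    unfolding N_def pos_def_msqrt(2)[OF M] unfolding M_def c_def by (subst mat_eq_scaleR) simp
  have "Y ** Y + (2 * c) *\<^sub>R Y = L"
    unfolding Y_def
    by (simp add: matrix_ring_simps NN) (simp add: vec_eq_iff algebra_simps power2_eq_square)
  have "X ** S1 ** X = Q ** Y ** (Q ** R) ** (R ** Q) ** Y ** Q"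
    by (simp add: XY R(2)[symmetric] matrix_mul_assoc)
  also have "\<dots> = Q ** (Y ** Y) ** Q" by (simp add: QR matrix_mul_assoc)
  finally have "X ** S1 ** X + (2 * c) *\<^sub>R X = Q ** (Y ** Y + (2 * c) *\<^sub>R Y) ** Q"
    by (simp add: XY matrix_ring_simps)
  also have "\<dots> = (Q ** R) ** S2 ** (R ** Q)"
    unfolding \<open>Y ** Y + (2 * c) *\<^sub>R Y = L\<close> L_def by (simp add: matrix_mul_assoc)
  finally show "X ** S1 ** X + (\<epsilon>/2) *\<^sub>R X = S2" by (simp add: QR c_def)
qed

section \<open>The joint Gaussian density factored in both orders\<close>

context
  fixes S1 S2 X K :: "real^'n^'n" and \<epsilon> :: real
  assumes S1: "pos_def_mat S1" and S2: "pos_def_mat S2" and X: "pos_def_mat X" and \<epsilon>: "0 < \<epsilon>"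
    and eq: "X ** S1 ** X + (\<epsilon>/2) *\<^sub>R X = S2"
    and K: "K = matrix_inv S1 + (2/\<epsilon>) *\<^sub>R X"
begin

lemma pos_def_K: "pos_def_mat K"
  unfolding K using \<epsilon> by (intro pos_def_add pos_def_scaleR pos_def_inverse S1 X) simp

text \<open>\<open>K\<close> is the precision block of \<open>x\<close> in the joint law, so its
  inverse is the conditional covariance of \<open>x\<close> given \<open>y\<close>. Multiplying out
  \<open>K ** S1 ** X\<close> gives back the equation for \<open>X\<close>; the determinant and the
  inverse of \<open>S2\<close> are both obtained from this product.\<close>

lemma S2_factor: "S2 = (\<epsilon>/2) *\<^sub>R (K ** S1 ** X)"
  unfolding K using \<epsilon>
  by (simp add: matrix_ring_simps pos_def_matrix_inv[OF S1] eq[symmetric] algebra_simps)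

text \<open>The joint covariance determinant, computed by conditioning on either coordinate; it
  matches the normalising constants in \<open>gaussian_pdf_factor\<close>.\<close>

lemma det_factor: "det S1 * det ((\<epsilon>/2) *\<^sub>R X) = det S2 * det (matrix_inv K)"
proof -
  have "det K * det (matrix_inv K) = 1"
    using pos_def_matrix_inv[OF pos_def_K] by (metis det_I det_mul)
  then show ?thesis by (simp add: S2_factor det_scaleR det_mul)
qed

text \<open>The Schur complement formula: the precision of the second marginal is the
  \<open>y\<close> block of the joint precision, corrected by eliminating \<open>x\<close>.\<close>

lemma S2_inverse: "matrix_inv S2 = (2/\<epsilon>) *\<^sub>R matrix_inv X - (2/\<epsilon>)\<^sup>2 *\<^sub>R matrix_inv K"
proof (rule matrix_inv_eqI)
  note inv = pos_def_matrix_inv[OF S1] pos_def_matrix_inv[OF pos_def_K] pos_def_matrix_inv[OF X]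
  have "S2 ** ((2/\<epsilon>) *\<^sub>R matrix_inv X - (2/\<epsilon>)\<^sup>2 *\<^sub>R matrix_inv K)
      = K ** S1 ** (X ** matrix_inv X) - (2/\<epsilon>) *\<^sub>R (K ** S1 ** X ** matrix_inv K)"
    unfolding S2_factor using \<epsilon>
    by (simp add: matrix_mul_scaleR_left matrix_mul_scaleR_right matrix_diff_ldistrib
        scaleR_diff_right power2_eq_square flip: matrix_mul_assoc)
  also have "\<dots> = K ** S1 ** (K ** matrix_inv K) - (2/\<epsilon>) *\<^sub>R (K ** S1 ** X ** matrix_inv K)"
    by (simp add: inv)
  also have "\<dots> = K ** S1 ** (K - (2/\<epsilon>) *\<^sub>R X) ** matrix_inv K"
    by (simp add: matrix_ring_simps)
  also have "\<dots> = K ** (S1 ** matrix_inv S1) ** matrix_inv K"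
    by (simp add: K matrix_mul_assoc)
  also have "\<dots> = mat 1" by (simp add: inv)
  finally show "S2 ** ((2/\<epsilon>) *\<^sub>R matrix_inv X - (2/\<epsilon>)\<^sup>2 *\<^sub>R matrix_inv K) = mat 1" .
qed

text \<open>Since the conditional covariance is a multiple of the regression matrix
  \<open>X\<close>, the matrix cancels from the mixed term and leaves a plain
  \<open>u \<bullet> v\<close>, just as in the squared distance.\<close>

lemma conditional_form:
  "(v - X *v u) \<bullet> (matrix_inv ((\<epsilon>/2) *\<^sub>R X) *v (v - X *v u))
    = (2/\<epsilon>) * (v \<bullet> (matrix_inv X *v v) - 2 * (u \<bullet> v) + u \<bullet> (X *v u))"
proof -
  have 1: "matrix_inv X *v (X *v w) = w" for w
    by (simp add: matrix_vector_mul_assoc pos_def_matrix_inv[OF X])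
  have 2: "(X *v u) \<bullet> (matrix_inv X *v w) = u \<bullet> w" for w
    using symmetric_inner[OF pos_def_symmetric[OF X]]
    by (simp add: matrix_vector_mul_assoc pos_def_matrix_inv[OF X])
  show ?thesis
    using \<epsilon> by (simp add: matrix_inv_scaleR pos_def_invertible[OF X] scaleR_matrix_vector_assoc[symmetric]
      algebra_simps 1 2 inner_commute)
qed

text \<open>The same joint quadratic form with the square completed in \<open>u\<close> instead of
  \<open>v\<close>.\<close>

lemma quadratic_form_factor:
  "u \<bullet> (matrix_inv S1 *v u) + (v - X *v u) \<bullet> (matrix_inv ((\<epsilon>/2) *\<^sub>R X) *v (v - X *v u))
    = v \<bullet> (matrix_inv S2 *v v)
      + (u - ((2/\<epsilon>) *\<^sub>R matrix_inv K) *v v) \<bullet> (K *v (u - ((2/\<epsilon>) *\<^sub>R matrix_inv K) *v v))"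
proof -
  let ?w = "matrix_inv K *v v"
  have 1: "K *v ?w = v"
    by (simp add: matrix_vector_mul_assoc pos_def_matrix_inv[OF pos_def_K])
  have 2: "(K *v u) \<bullet> ?w = u \<bullet> v" "?w \<bullet> (K *v u) = u \<bullet> v"
    using symmetric_inner[OF pos_def_symmetric[OF pos_def_K], of u ?w]
    by (simp_all only: 1 inner_commute)
  have "(u - (2/\<epsilon>) *\<^sub>R ?w) \<bullet> (K *v (u - (2/\<epsilon>) *\<^sub>R ?w))
      = u \<bullet> (K *v u) - (4/\<epsilon>) * (u \<bullet> v) + (2/\<epsilon>)\<^sup>2 * (v \<bullet> ?w)"
    by (simp add: matrix_vector_mult_diff_distrib matrix_vector_mult_scaleR 1 2 inner_diff_left
        inner_diff_right inner_commute power2_eq_square algebra_simps)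
  moreover have "u \<bullet> (K *v u) = u \<bullet> (matrix_inv S1 *v u) + (2/\<epsilon>) * (u \<bullet> (X *v u))"
    by (simp add: K matrix_vector_mult_add_rdistrib inner_add_right scaleR_matrix_vector_assoc[symmetric])
  moreover have "v \<bullet> (matrix_inv S2 *v v) = (2/\<epsilon>) * (v \<bullet> (matrix_inv X *v v)) - (2/\<epsilon>)\<^sup>2 * (v \<bullet> ?w)"
    by (simp add: S2_inverse matrix_vector_mult_diff_rdistrib inner_diff_right scaleR_matrix_vector_assoc[symmetric])
  moreover have "4/\<epsilon> = 2 * (2/\<epsilon>)" by simp
  ultimately show ?thesis
    unfolding conditional_form scaleR_matrix_vector_assoc[symmetric] by algebra
qed

text \<open>Bayes' rule for the joint density; the right-hand side can be integrated over
  \<open>x\<close>, which yields the second marginal.\<close>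

lemma gaussian_pdf_factor:
  "gaussian_pdf m1 S1 x * gaussian_pdf (m2 + X *v (x - m1)) ((\<epsilon>/2) *\<^sub>R X) y
    = gaussian_pdf m2 S2 y *
      gaussian_pdf (m1 + ((2/\<epsilon>) *\<^sub>R matrix_inv K) *v (y - m2)) (matrix_inv K) x"
proof -
  have pos: "0 < det S1" "0 < det S2" "0 < det ((\<epsilon>/2) *\<^sub>R X)" "0 < det (matrix_inv K)"
    using \<epsilon> by (auto intro!: pos_def_det_pos S1 S2 pos_def_scaleR X pos_def_inverse pos_def_K)
  have "det S1 powr (-1/2) * det ((\<epsilon>/2) *\<^sub>R X) powr (-1/2)
      = det S2 powr (-1/2) * det (matrix_inv K) powr (-1/2)"
    using pos det_factor by (simp flip: powr_mult)
  moreover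
  have "exp (- (1/2) * ((x - m1) \<bullet> (matrix_inv S1 *v (x - m1)))) *
      exp (- (1/2) * ((y - (m2 + X *v (x - m1))) \<bullet> (matrix_inv ((\<epsilon>/2) *\<^sub>R X) *v (y - (m2 + X *v (x - m1))))))
    = exp (- (1/2) * ((y - m2) \<bullet> (matrix_inv S2 *v (y - m2)))) *
      exp (- (1/2) * ((x - (m1 + ((2/\<epsilon>) *\<^sub>R matrix_inv K) *v (y - m2))) \<bullet> (matrix_inv (matrix_inv K) *v
          (x - (m1 + ((2/\<epsilon>) *\<^sub>R matrix_inv K) *v (y - m2))))))"
    using quadratic_form_factor[of "x - m1" "y - m2"]
    unfolding exp_add[symmetric] distrib_left[symmetric] matrix_inv_matrix_inv[OF pos_def_K]
    by (simp add: diff_diff_eq)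
  ultimately show ?thesis
    unfolding gaussian_pdf_def by algebra
qed

end

subsection \<open>The standard Gaussian measure\<close>

lemma orthogonal_matrix_norm:
  fixes U :: "real^'n^'n"
  assumes "orthogonal_matrix U"
  shows "norm (U *v x) = norm x"
  using quadratic_form_congruence[of x U "mat 1"] assms
  by (simp add: orthogonal_matrix_def norm_eq_sqrt_inner)

lemma borel_measurable_matrix_vector [measurable]: "(*v) (A :: real^'n^'m) \<in> borel_measurable borel"
  by (intro borel_measurable_continuous_onI linear_continuous_on linear_conv_bounded_linear[THEN iffD1]
      matrix_vector_mul_linear)

text \<open>Uniqueness of Haar measure, proved by a double integral against the indicator of a ball: the
  change of variables results of the library only cover well-ordered index types.\<close>
lemma lborel_distr_orthogonal:
  fixes U :: "real^'n^'n"
  assumes U: "orthogonal_matrix U"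
  shows "distr lborel borel ((*v) U) = lborel"
proof (rule measure_eqI)
  have UU: "U *v (transpose U *v x) = x" "transpose U *v (U *v x) = x" for x
    using U by (simp_all add: matrix_vector_mul_assoc orthogonal_matrix_def del: transpose_matrix_vector)
  have norm_U: "norm (U *v x) = norm x" for x
    using U by (rule orthogonal_matrix_norm)
  let ?B = "ball (0 :: real^'n) 1"
  have [measurable]: "?B \<in> sets borel" by simp
  have ball: "emeasure lborel (ball z 1) = emeasure lborel ?B" for z :: "real^'n"
    by (simp add: emeasure_ball)
  fix A :: "(real^'n) set" assume "A \<in> sets (distr lborel borel ((*v) U))"
  then have [measurable]: "A \<in> sets borel" by simp
  have shift: "(\<integral>\<^sup>+y. f y \<partial>lborel) = (\<integral>\<^sup>+y. f (c + y) \<partial>lborel)"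
    if "f \<in> borel_measurable borel" for f and c :: "real^'n"
    using that by (subst lborel_distr_plus[of c, symmetric]) (simp add: nn_integral_distr)
  \<comment> \<open>A shift by \<open>x\<close> after applying \<open>U\<close> is a shift by
    \<open>transpose U *v x\<close> before it.\<close>
  have 1: "(\<integral>\<^sup>+y. indicator A (U *v y) \<partial>lborel) = (\<integral>\<^sup>+y. indicator A (x + U *v y) \<partial>lborel)" for x
    by (subst shift[of _ "transpose U *v x"])
      (simp_all add: matrix_vector_right_distrib UU del: transpose_matrix_vector)
  have 2: "(\<integral>\<^sup>+x. indicator ?B x * indicator A (x + U *v y) \<partial>lborel)
      = (\<integral>\<^sup>+x. indicator ?B (x - U *v y) * (indicator A x :: ennreal) \<partial>lborel)" for y
    by (subst (2) shift[of _ "U *v y"]) (simp_all add: add.commute)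
  \<comment> \<open>Norm preservation enters here: the points \<open>y\<close> for which
    \<open>x - U *v y\<close> lies in the unit ball form the unit ball around
    \<open>transpose U *v x\<close>.\<close>
  have 3: "(\<integral>\<^sup>+y. indicator ?B (x - U *v y) \<partial>lborel) = emeasure lborel ?B" for x
  proof -
    have "(\<integral>\<^sup>+y. indicator ?B (x - U *v y) \<partial>lborel)
        = (\<integral>\<^sup>+y. indicator (ball (transpose U *v x) 1) y \<partial>(lborel :: (real^'n) measure))"
    proof (rule nn_integral_cong)
      fix y
      have "norm (x - U *v y) = norm (U *v (transpose U *v x - y))"
        by (simp only: matrix_vector_mult_diff_distrib UU)
      then have "x - U *v y \<in> ?B \<longleftrightarrow> y \<in> ball (transpose U *v x) 1"
        by (simp only: norm_U mem_ball dist_norm diff_0 norm_minus_cancel)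
      then show "(indicator ?B (x - U *v y) :: ennreal) = indicator (ball (transpose U *v x) 1) y"
        by (simp only: indicator_def)
    qed
    also have "\<dots> = emeasure lborel ?B" 
      by (simp add: ball[of "transpose U *v x"] del: transpose_matrix_vector)
    finally show ?thesis .
  qed
  have "emeasure lborel ?B * emeasure (distr lborel borel ((*v) U)) A
      = (\<integral>\<^sup>+x. indicator ?B x * (\<integral>\<^sup>+y. indicator A (U *v y) \<partial>lborel) \<partial>lborel)"
    using nn_integral_distr[of "(*v) U" lborel borel "indicator A"] by (simp add: nn_integral_multc)
  also have "\<dots> = (\<integral>\<^sup>+x. (\<integral>\<^sup>+y. indicator ?B x * indicator A (x + U *v y) \<partial>lborel) \<partial>lborel)"
  proof (rule nn_integral_cong)
    fix x
    show "indicator ?B x * (\<integral>\<^sup>+y. indicator A (U *v y) \<partial>lborel)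
        = (\<integral>\<^sup>+y. indicator ?B x * indicator A (x + U *v y) \<partial>lborel)"
      unfolding 1[of x] by (simp add: nn_integral_cmult)
  qed
  also have "\<dots> = (\<integral>\<^sup>+y. (\<integral>\<^sup>+x. indicator ?B x * indicator A (x + U *v y) \<partial>lborel) \<partial>lborel)"
    by (rule lborel_pair.Fubini') measurable
  also have "\<dots> = (\<integral>\<^sup>+y. (\<integral>\<^sup>+x. indicator ?B (x - U *v y) * indicator A x \<partial>lborel) \<partial>lborel)"
    by (simp add: 2)
  also have "\<dots> = (\<integral>\<^sup>+x. (\<integral>\<^sup>+y. indicator ?B (x - U *v y) * indicator A x \<partial>lborel) \<partial>lborel)"
    by (rule lborel_pair.Fubini') measurable
  also have "\<dots> = (\<integral>\<^sup>+x. emeasure lborel ?B * indicator A x \<partial>lborel)"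
    by (simp add: nn_integral_multc 3)
  also have "\<dots> = emeasure lborel ?B * emeasure lborel A"
    by (simp add: nn_integral_cmult)
  finally have *: "emeasure lborel ?B * emeasure (distr lborel borel ((*v) U)) A
      = emeasure lborel ?B * emeasure lborel A" .
  have "unit_ball_vol (real CARD('n)) \<noteq> 0" 
    by (metis unit_ball_vol_pos less_irrefl of_nat_0_le_iff)
  with * show "emeasure (distr lborel borel ((*v) U)) A = emeasure lborel A"
    by (simp add: ennreal_mult_cancel_left emeasure_ball)
qed simp

text \<open>Scaling of \<open>lborel\<close> along \<open>Basis\<close> vectors, reindexed by
  coordinates: the inverse of the injection \<open>axis\<close> recovers the index from a basis
  vector.\<close>

lemma nn_integral_lborel_diag:
  fixes f :: "real^'n \<Rightarrow> ennreal"
  assumes [measurable]: "f \<in> borel_measurable borel" and "\<And>i. c i \<noteq> 0"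
  shows "(\<integral>\<^sup>+x. f x \<partial>lborel) = ennreal (\<Prod>i\<in>UNIV. \<bar>c i\<bar>) * (\<integral>\<^sup>+x. f (diag_mat c *v x) \<partial>lborel)"
proof -
  let ?e = "\<lambda>i :: 'n. axis i (1::real)"
  have inj: "inj ?e" by (auto simp: inj_def axis_eq_axis)
  have Basis: "(Basis :: (real^'n) set) = range ?e" by (auto simp: Basis_vec_def)
  let ?c = "\<lambda>b. c (inv ?e b)"
  have ce: "?c (?e i) = c i" for i using inv_f_f[OF inj, of i] by simp
  have T: "(0 + (\<Sum>j\<in>Basis. (?c j * (x \<bullet> j)) *\<^sub>R j)) = diag_mat c *v x" for x
  proof -
    have "(\<Sum>j\<in>Basis. (?c j * (x \<bullet> j)) *\<^sub>R j) = (\<Sum>i\<in>UNIV. (c i * x $ i) *\<^sub>R ?e i)"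
      unfolding Basis by (subst sum.reindex[OF inj]) (simp add: ce inner_axis)
    then show ?thesis
      by (simp add: vec_eq_iff diag_mat_vec axis_def if_distrib[where f="\<lambda>t. _ * t"] cong: if_cong)
  qed
  have P: "(\<Prod>j\<in>Basis. \<bar>?c j\<bar>) = (\<Prod>i\<in>UNIV. \<bar>c i\<bar>)"
    unfolding Basis by (simp add: prod.reindex[OF inj] ce)
  have *: "lborel = density (distr lborel borel ((*v) (diag_mat c))) (\<lambda>_. ennreal (\<Prod>i\<in>UNIV. \<bar>c i\<bar>))"
    using lborel_affine_euclidean[of ?c "0 :: real^'n"] assms(2) unfolding T P by simp
  show ?thesis
    by (subst *) (simp add: nn_integral_density nn_integral_distr nn_integral_cmult)
qed

text \<open>The product form reduces mass and moments to one-dimensional integrals; rotation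
  invariance is read off the exponential form in \<open>std_gauss_pdf_alt\<close>.\<close>

definition std_gauss_pdf :: "real^'n \<Rightarrow> real" where
  "std_gauss_pdf z = (\<Prod>i\<in>UNIV. std_normal_density (z $ i))"

definition std_gauss :: "(real^'n) measure" where
  "std_gauss = density lborel (\<lambda>z. ennreal (std_gauss_pdf z))"

lemma std_gauss_pdf_alt:
  fixes z :: "real^'n"
  shows "std_gauss_pdf z = (2 * pi) powr (- real CARD('n) / 2) * exp (- (1/2) * (z \<bullet> z))"
proof -
  have "(1 / sqrt (2 * pi)) ^ CARD('n) = (2 * pi) powr (- real CARD('n) / 2)"
    by (simp add: powr_half_sqrt[symmetric] powr_minus_divide[symmetric] powr_realpow[symmetric] powr_powr
        flip: powr_power)
  moreover have "(\<Prod>i\<in>UNIV. exp (- (z $ i)\<^sup>2 / 2)) = exp (- (1/2) * (z \<bullet> z))"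
    by (simp add: exp_sum[symmetric] inner_vec_def power2_eq_square sum_negf sum_divide_distrib)
  ultimately show ?thesis
    unfolding std_gauss_pdf_def std_normal_density_def prod.distrib by simp
qed

lemma std_gauss_pdf_nonneg [simp]: "0 \<le> std_gauss_pdf z"
  by (simp add: std_gauss_pdf_def prod_nonneg)

lemma borel_measurable_std_gauss_pdf [measurable]: "std_gauss_pdf \<in> borel_measurable borel"
  unfolding std_gauss_pdf_def by measurable

lemma sets_std_gauss [measurable_cong, simp]: "sets std_gauss = sets borel"
  by (simp add: std_gauss_def)

lemma space_std_gauss [simp]: "space std_gauss = UNIV"
  by (simp add: std_gauss_def)

lemma nn_integral_lborel_vec_prod:
  fixes f :: "'n::finite \<Rightarrow> real \<Rightarrow> ennreal"
  assumes [measurable]: "\<And>i. f i \<in> borel_measurable borel"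
  shows "(\<integral>\<^sup>+x. (\<Prod>i\<in>UNIV. f i (x $ i)) \<partial>(lborel :: (real^'n) measure)) = (\<Prod>i\<in>UNIV. \<integral>\<^sup>+t. f i t \<partial>lborel)"
proof -
  let ?e = "\<lambda>i :: 'n. axis i (1::real)"
  have inj: "inj ?e" by (auto simp: inj_def axis_eq_axis)
  have Basis: "(Basis :: (real^'n) set) = range ?e" by (auto simp: Basis_vec_def)
  have ce: "inv ?e (?e i) = i" for i using inv_f_f[OF inj, of i] by simp
  have "(\<integral>\<^sup>+x. (\<Prod>b\<in>Basis. f (inv ?e b) (x \<bullet> b)) \<partial>(lborel :: (real^'n) measure))
      = (\<Prod>b\<in>Basis. \<integral>\<^sup>+t. f (inv ?e b) t \<partial>lborel)"
    by (rule nn_integral_lborel_prod) auto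
  then show ?thesis
    unfolding Basis by (simp add: prod.reindex[OF inj] ce inner_axis)
qed

lemma prob_space_std_gauss: "prob_space (std_gauss :: (real^'n) measure)"
proof
  have "emeasure (std_gauss :: (real^'n) measure) UNIV
      = (\<integral>\<^sup>+x. (\<Prod>i\<in>UNIV. ennreal (std_normal_density (x $ i))) \<partial>(lborel :: (real^'n) measure))"
    by (simp add: std_gauss_def emeasure_density std_gauss_pdf_def prod_ennreal)
  also have "\<dots> = 1"
    by (subst nn_integral_lborel_vec_prod) (auto simp: nn_integral_eq_integral)
  finally show "emeasure (std_gauss :: (real^'n) measure) (space std_gauss) = 1" by simp
qed

lemma std_gauss_second_moment:
  "(\<integral>\<^sup>+x. ennreal ((x $ k)\<^sup>2) \<partial>(std_gauss :: (real^'n) measure)) = 1"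
proof -
  \<comment> \<open>Only factor \<open>k\<close> carries the square; every other factor integrates
    to 1.\<close>
  let ?f = "\<lambda>i t. ennreal (if i = k then std_normal_density t * t\<^sup>2 else std_normal_density t)"
  have 2: "(\<integral>\<^sup>+t. ennreal (std_normal_density t * t\<^sup>2) \<partial>lborel) = 1"
    using std_normal_moment_even[of 1] by (subst nn_integral_eq_integral)
      (auto simp: has_bochner_integral_iff)
  have "(\<integral>\<^sup>+x. ennreal ((x $ k)\<^sup>2) \<partial>(std_gauss :: (real^'n) measure))
      = (\<integral>\<^sup>+x. ennreal (std_gauss_pdf x) * ennreal ((x $ k)\<^sup>2) \<partial>lborel)"
    by (simp add: std_gauss_def nn_integral_density)
  also have "\<dots> = (\<integral>\<^sup>+x. (\<Prod>i\<in>UNIV. ?f i (x $ i)) \<partial>(lborel :: (real^'n) measure))"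
  proof (rule nn_integral_cong)
    fix x :: "real^'n"
    have "(\<Prod>i\<in>UNIV. if i = k then std_normal_density (x $ i) * (x $ i)\<^sup>2 else std_normal_density (x $ i))
        = (\<Prod>i\<in>UNIV. std_normal_density (x $ i) * (if i = k then (x $ i)\<^sup>2 else 1))"
      by (rule prod.cong) auto
    also have "\<dots> = std_gauss_pdf x * (x $ k)\<^sup>2"
      by (simp add: prod.distrib std_gauss_pdf_def)
    finally show "ennreal (std_gauss_pdf x) * ennreal ((x $ k)\<^sup>2) = (\<Prod>i\<in>UNIV. ?f i (x $ i))"
      by (simp add: prod_ennreal ennreal_mult)
  qed
  also have "\<dots> = (\<Prod>i\<in>UNIV. \<integral>\<^sup>+t. ?f i t \<partial>lborel)"
    by (rule nn_integral_lborel_vec_prod) simp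
  also have "\<dots> = 1"
    by (intro prod.neutral ballI, case_tac "x = k") (auto simp: 2 nn_integral_eq_integral)
  finally show ?thesis .
qed

lemma std_gauss_orthogonal:
  fixes U :: "real^'n^'n"
  assumes U: "orthogonal_matrix U"
  shows "distr std_gauss borel ((*v) U) = std_gauss"
proof -
  have "norm (U *v x) = norm x" for x
    using U by (rule orthogonal_matrix_norm)
  then have *: "std_gauss_pdf (U *v x) = std_gauss_pdf x" for x
    by (simp add: std_gauss_pdf_alt dot_square_norm)
  have "density lborel (\<lambda>z. ennreal (std_gauss_pdf z))
      = density (distr lborel borel ((*v) U)) (\<lambda>z. ennreal (std_gauss_pdf z))"
    by (simp add: lborel_distr_orthogonal[OF U])
  also have "\<dots> = distr (density lborel (\<lambda>z. ennreal (std_gauss_pdf (U *v z)))) borel ((*v) U)"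
    by (rule density_distr) measurable
  finally show ?thesis by (simp add: std_gauss_def *)
qed

lemma std_gauss_integrable:
  fixes i j :: "'n::finite"
  shows
  "integrable std_gauss (\<lambda>x. x $ i)" "integrable std_gauss (\<lambda>x. x $ i * x $ j)"
proof -
  interpret prob_space "std_gauss :: (real^'n) measure" by (rule prob_space_std_gauss)
  have sq: "integrable std_gauss (\<lambda>x :: real^'n. (x $ k)\<^sup>2)" for k
    by (rule integrableI_nonneg) (auto simp: std_gauss_second_moment)
  show "integrable std_gauss (\<lambda>x. x $ i)"
    by (rule square_integrable_imp_integrable) (simp_all add: sq)
  show "integrable std_gauss (\<lambda>x. x $ i * x $ j)"
  proof (rule Bochner_Integration.integrable_bound)
    show "integrable std_gauss (\<lambda>x. (x $ i)\<^sup>2 + (x $ j)\<^sup>2)" by (intro Bochner_Integration.integrable_add sq)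
    have "\<bar>a * b\<bar> \<le> a\<^sup>2 + b\<^sup>2" for a b :: real
    proof -
      have "2 * (\<bar>a\<bar> * \<bar>b\<bar>) \<le> a\<^sup>2 + b\<^sup>2" using sum_squares_bound[of "\<bar>a\<bar>" "\<bar>b\<bar>"] by simp
      moreover have "0 \<le> \<bar>a\<bar> * \<bar>b\<bar>" by simp
      ultimately show ?thesis unfolding abs_mult by linarith
    qed
    then show "AE x in std_gauss. norm (x $ i * x $ j) \<le> norm ((x $ i)\<^sup>2 + (x $ j)\<^sup>2)" by simp
  qed simp
qed

text \<open>The vanishing moments follow from invariance under the reflection of one coordinate.\<close>
lemma std_gauss_moments:
  fixes i j :: "'n::finite"
  shows
  "(\<integral>x. x $ i \<partial>std_gauss) = 0" "(\<integral>x. x $ i * x $ j \<partial>std_gauss) = (if i = j then 1 else 0)"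
proof -
  let ?R = "diag_mat (\<lambda>k. if k = i then - 1 else 1) :: real^'n^'n"
  have "?R ** ?R = diag_mat (\<lambda>_. 1)" by (simp add: diag_mat_mult) (rule arg_cong[where f=diag_mat], auto)
  then have R: "orthogonal_matrix ?R" by (simp add: orthogonal_matrix diag_mat_one)
  have refl: "(\<integral>x. f x \<partial>std_gauss) = (\<integral>x. f (?R *v x) \<partial>std_gauss)"
    if "f \<in> borel_measurable borel" for f :: "real^'n \<Rightarrow> real"
    using that by (subst std_gauss_orthogonal[OF R, symmetric]) (simp add: integral_distr)
  show "(\<integral>x. x $ i \<partial>std_gauss) = 0"
    using refl[of "\<lambda>x. x $ i"] by (simp add: diag_mat_vec)
  show "(\<integral>x. x $ i * x $ j \<partial>std_gauss) = (if i = j then 1 else 0)"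
  proof (cases "i = j")
    case True
    have "(\<integral>x. (x $ i)\<^sup>2 \<partial>(std_gauss :: (real^'n) measure)) = 1"
      by (subst integral_eq_nn_integral) (auto simp: std_gauss_second_moment)
    then show ?thesis using True by (simp add: power2_eq_square)
  next
    case False
    then show ?thesis using refl[of "\<lambda>x. x $ i * x $ j"] by (simp add: diag_mat_vec)
  qed
qed

subsection \<open>General Gaussian measures\<close>

lemma gaussian_pdf_pos:
  assumes "pos_def_mat S"
  shows "0 < gaussian_pdf m S x"
  using pos_def_det_pos[OF assms] by (simp add: gaussian_pdf_def)

lemma borel_measurable_gaussian_pdf [measurable]: "gaussian_pdf m S \<in> borel_measurable borel"
  unfolding gaussian_pdf_def by measurable

lemma matrix_vec_cov:
  fixes A :: "real^'n^'n"
  shows "((A *v z) $ i) * ((A *v z) $ j) = (\<Sum>k\<in>UNIV. \<Sum>l\<in>UNIV. A $ i $ k * A $ j $ l * (z $ k * z $ l))"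
  unfolding matrix_vector_mult_def by (simp add: sum_product mult_ac)

lemma std_gauss_cov:
  fixes A :: "real^'n^'n"
  shows "(\<integral>z. ((A *v z) $ i) * ((A *v z) $ j) \<partial>std_gauss) = (A ** transpose A) $ i $ j"
proof -
  have "(\<integral>z. ((A *v z) $ i) * ((A *v z) $ j) \<partial>std_gauss)
      = (\<Sum>k\<in>UNIV. \<Sum>l\<in>UNIV. A $ i $ k * A $ j $ l * (if k = l then 1 else 0))"
    unfolding matrix_vec_cov
    by (simp add: Bochner_Integration.integral_sum std_gauss_integrable std_gauss_moments
        Bochner_Integration.integrable_sum)
  also have "\<dots> = (A ** transpose A) $ i $ j"
    by (simp add: matrix_matrix_mult_def transpose_def if_distrib[where f="\<lambda>t. _ * t"] cong: if_cong)
  finally show ?thesis .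
qed

lemma std_gauss_linear_mean:
  fixes A :: "real^'n^'n"
  shows "(\<integral>z. (A *v z) $ i \<partial>std_gauss) = 0" "integrable std_gauss (\<lambda>z. (A *v z) $ i)"
  unfolding matrix_vector_mult_def
  by (simp_all add: Bochner_Integration.integral_sum std_gauss_integrable std_gauss_moments
      Bochner_Integration.integrable_sum)

definition gaussian_measure :: "real^'n \<Rightarrow> real^'n^'n \<Rightarrow> (real^'n) measure" where
  "gaussian_measure m S = density lborel (\<lambda>x. ennreal (gaussian_pdf m S x))"

lemma sets_gaussian_measure [simp, measurable_cong]: "sets (gaussian_measure m S) = sets borel"
  by (simp add: gaussian_measure_def)

text \<open>Take \<open>A = U ** D\<close> with \<open>D\<close> the root of the diagonal part. The
  map factors into a scaling, a rotation and a translation, whose effects on \<open>lborel\<close>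
  are known, and the Jacobian \<open>C = sqrt (det S)\<close> cancels the determinant in the
  density. Mass, mean and covariance are then inherited from \<open>std_gauss\<close>.\<close>

lemma gaussian_measure_eq_distr:
  fixes S :: "real^'n^'n"
  assumes "pos_def_mat S"
  obtains A :: "real^'n^'n" where "A ** transpose A = S" "gaussian_measure m S = distr std_gauss borel (\<lambda>z. m + A *v z)"
proof -
  obtain U d where U: "orthogonal_matrix U" and S: "S = U ** diag_mat d ** transpose U"
    and d: "\<And>i. 0 < d i"
    using pos_def_spectral[OF assms] by metis
  define D where "D = diag_mat (\<lambda>i. sqrt (d i))"
  define A where "A = U ** D"
  have UU: "U ** transpose U = mat 1" "transpose U ** U = mat 1"
    using U by (simp_all add: orthogonal_matrix_def)
  have DD: "D ** D = diag_mat d"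
    using d by (simp add: D_def diag_mat_mult less_imp_le)
  have AA: "A ** transpose A = S"
    unfolding A_def S DD[symmetric] by (simp add: matrix_transpose_mul D_def matrix_mul_assoc)
  have det: "det S = (\<Prod>i\<in>UNIV. d i)" unfolding S by (rule det_orthogonal_sandwich[OF U])
  \<comment> \<open>With \<open>B\<close> the inverse of \<open>A\<close>, the inverse of
    \<open>S\<close> is \<open>transpose B ** B\<close>, so the form is the squared length of
    \<open>B *v (A *v z)\<close>.\<close>
  have form: "(A *v z) \<bullet> (matrix_inv S *v (A *v z)) = z \<bullet> z" for z
  proof -
    have "det S \<noteq> 0" using pos_def_det_pos[OF assms] by simp
    then have "det A \<noteq> 0" unfolding AA[symmetric] det_mul by simp
    then have inv: "invertible A" by (simp add: invertible_det_nz)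
    then obtain B where B: "A ** B = mat 1" "B ** A = mat 1" by (auto simp: invertible_def)
    have "transpose A ** transpose B = mat 1"
      using B by (metis matrix_transpose_mul transpose_mat)
    then have "A ** (transpose A ** transpose B) ** B = mat 1" using B by simp
    then have "S ** (transpose B ** B) = mat 1" by (simp add: AA[symmetric] matrix_mul_assoc)
    then have "matrix_inv S = transpose B ** B" by (rule matrix_inv_eqI)
    then have "(A *v z) \<bullet> (matrix_inv S *v (A *v z)) = (A *v z) \<bullet> ((transpose B ** mat 1 ** B) *v (A *v z))"
      by simp
    also have "\<dots> = (B *v (A *v z)) \<bullet> (B *v (A *v z))"
      by (subst quadratic_form_congruence) simp
    also have "\<dots> = z \<bullet> z" by (simp add: matrix_vector_mul_assoc B)
    finally show ?thesis .
  qed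
  define C where "C = (\<Prod>i\<in>UNIV. \<bar>sqrt (d i)\<bar>)"
  have "C\<^sup>2 = det S" "0 \<le> C"
    unfolding det C_def using d by (simp_all add: prod_power_distrib less_imp_le prod_nonneg)
  then have "C = sqrt (det S)" by (simp add: real_sqrt_unique)
  then have C: "C * det S powr (-1/2) = 1"
    using pos_def_det_pos[OF assms]
    by (simp add: powr_half_sqrt[symmetric] powr_minus_divide flip: powr_add)
  have pdf: "C * gaussian_pdf m S (m + A *v z) = std_gauss_pdf z" for z
    using C unfolding std_gauss_pdf_alt gaussian_pdf_def add_diff_cancel_left' form
    by (simp add: mult_ac)
  have cv: "(\<integral>\<^sup>+x. f x \<partial>lborel) = ennreal C * (\<integral>\<^sup>+z. f (m + A *v z) \<partial>lborel)"
    if [measurable]: "f \<in> borel_measurable borel" for f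
  proof -
    have "(\<integral>\<^sup>+x. f x \<partial>lborel) = (\<integral>\<^sup>+x. f (m + x) \<partial>lborel)"
      by (subst lborel_distr_plus[of m, symmetric]) (simp add: nn_integral_distr)
    also have "\<dots> = (\<integral>\<^sup>+x. f (m + U *v x) \<partial>lborel)"
      by (subst lborel_distr_orthogonal[OF U, symmetric]) (simp add: nn_integral_distr)
    also have "\<dots> = ennreal C * (\<integral>\<^sup>+x. f (m + U *v (D *v x)) \<partial>lborel)"
      unfolding C_def D_def
    proof (rule nn_integral_lborel_diag)
      show "sqrt (d i) \<noteq> 0" for i using d[of i] by simp
    qed measurable
    finally show ?thesis by (simp add: A_def matrix_vector_mul_assoc)
  qed
  have "gaussian_measure m S = distr std_gauss borel (\<lambda>z. m + A *v z)"
  proof (rule measure_eqI)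
    fix E assume "E \<in> sets (gaussian_measure m S)"
    then have [measurable]: "E \<in> sets borel" by simp
    have "emeasure (gaussian_measure m S) E
        = (\<integral>\<^sup>+x. ennreal (gaussian_pdf m S x) * indicator E x \<partial>lborel)"
      unfolding gaussian_measure_def by (rule emeasure_density) auto
    also have "\<dots> = (\<integral>\<^sup>+z. ennreal C * (ennreal (gaussian_pdf m S (m + A *v z)) * indicator E (m + A *v z)) \<partial>lborel)"
      by (subst cv) (simp_all add: nn_integral_cmult)
    also have "\<dots> = (\<integral>\<^sup>+z. ennreal (std_gauss_pdf z) * indicator E (m + A *v z) \<partial>lborel)"
      using gaussian_pdf_pos[OF assms, of m]
      by (intro nn_integral_cong)
        (simp add: pdf[symmetric] ennreal_mult C_def prod_nonneg mult.assoc less_imp_le)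
    also have "\<dots> = (\<integral>\<^sup>+z. indicator E (m + A *v z) \<partial>std_gauss)"
      by (simp add: std_gauss_def nn_integral_density)
    also have "\<dots> = emeasure (distr std_gauss borel (\<lambda>z. m + A *v z)) E"
      using nn_integral_distr[of "\<lambda>z. m + A *v z" std_gauss borel "indicator E"] by simp
    finally show "emeasure (gaussian_measure m S) E = emeasure (distr std_gauss borel (\<lambda>z. m + A *v z)) E" .
  qed simp
  with AA that show thesis by blast
qed

lemma prob_space_gaussian_measure:
  fixes S :: "real^'n^'n"
  assumes "pos_def_mat S"
  shows "prob_space (gaussian_measure m S)"
proof -
  obtain A :: "real^'n^'n" where A: "A ** transpose A = S" "gaussian_measure m S = distr std_gauss borel (\<lambda>z. m + A *v z)"
    using gaussian_measure_eq_distr[OF assms, where m=m] .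
  show ?thesis unfolding A(2)
    by (rule prob_space.prob_space_distr[OF prob_space_std_gauss]) simp
qed

lemma nn_integral_gaussian_pdf:
  assumes "pos_def_mat S"
  shows "(\<integral>\<^sup>+x. ennreal (gaussian_pdf m S x) \<partial>lborel) = 1"
  using prob_space.emeasure_space_1[OF prob_space_gaussian_measure[OF assms, of m]]
  by (simp add: gaussian_measure_def emeasure_density)

lemma mean_vec_component:
  fixes P :: "(real^'n) measure"
  assumes "integrable P (\<lambda>x. x)"
  shows "mean_vec P $ i = (\<integral>x. x $ i \<partial>P)"
  unfolding mean_vec_def
  using integral_bounded_linear[OF bounded_linear_vec_nth assms, of i] by simp

lemma gaussian_measure_mean:
  fixes S :: "real^'n^'n"
  assumes "pos_def_mat S" "integrable (gaussian_measure m S) (\<lambda>x. x)"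
  shows "mean_vec (gaussian_measure m S) = m"
proof -
  obtain A :: "real^'n^'n" where A: "A ** transpose A = S" "gaussian_measure m S = distr std_gauss borel (\<lambda>z. m + A *v z)"
    using gaussian_measure_eq_distr[OF assms(1), where m=m] .
  interpret prob_space "std_gauss :: (real^'n) measure" by (rule prob_space_std_gauss)
  have "mean_vec (gaussian_measure m S) $ i = m $ i" for i
    unfolding mean_vec_component[OF assms(2)] unfolding A(2)
    by (subst integral_distr) (simp_all add: std_gauss_linear_mean prob_space[simplified])
  then show ?thesis by (simp add: vec_eq_iff)
qed

lemma gaussian_measure_cov:
  fixes S :: "real^'n^'n"
  assumes "pos_def_mat S" "integrable (gaussian_measure m S) (\<lambda>x. x)"
  shows "cov_mat (gaussian_measure m S) = S"
proof -
  obtain A :: "real^'n^'n" where A: "A ** transpose A = S" "gaussian_measure m S = distr std_gauss borel (\<lambda>z. m + A *v z)"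
    using gaussian_measure_eq_distr[OF assms(1), where m=m] .
  have "cov_mat (gaussian_measure m S) $ i $ j = S $ i $ j" for i j
    unfolding cov_mat_def gaussian_measure_mean[OF assms] unfolding A(2)
    by simp (subst integral_distr, simp_all add: std_gauss_cov A(1))
  then show ?thesis by (simp add: vec_eq_iff)
qed

subsection \<open>Relative entropy, moments and marginals\<close>

text \<open>The terms \<open>g - r\<close> integrate to \<open>0\<close> for probability densities and make the integrand of the
  relative entropy pointwise nonnegative.\<close>
definition kl_integrand :: "real \<Rightarrow> real \<Rightarrow> real" where
  "kl_integrand r g = r * ln (r / g) - r + g"

text \<open>Apply \<open>ln s \<le> s - 1\<close> at \<open>s = sqrt (g / r)\<close>. Using
  \<open>g / r\<close> itself would give only nonnegativity; the root leaves the squared Hellinger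
  difference as a gain.\<close>

lemma kl_integrand_ge_hellinger:
  assumes "0 \<le> r" "0 < g"
  shows "(sqrt r - sqrt g)\<^sup>2 \<le> kl_integrand r g"
proof (cases "r = 0")
  case True
  then show ?thesis using assms by (simp add: kl_integrand_def)
next
  case False
  then have r: "0 < r" using assms by simp
  have "ln (sqrt (g / r)) \<le> sqrt (g / r) - 1"
    using r assms by (intro ln_le_minus_one) simp
  moreover have "ln (sqrt (g / r)) = - ln (r / g) / 2"
    using r assms by (simp add: ln_sqrt ln_div field_simps)
  ultimately have "2 - 2 * sqrt (g / r) \<le> ln (r / g)" by simp
  then have "r * (2 - 2 * sqrt (g / r)) \<le> r * ln (r / g)" using r by (intro mult_left_mono) auto
  moreover have "r * sqrt (g / r) = sqrt r * sqrt g"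
    using r by (simp add: real_sqrt_divide real_div_sqrt field_simps)
  ultimately show ?thesis
    using r assms by (simp add: kl_integrand_def power2_diff algebra_simps)
qed

lemma kl_integrand_nonneg: "0 \<le> r \<Longrightarrow> 0 < g \<Longrightarrow> 0 \<le> kl_integrand r g"
  using kl_integrand_ge_hellinger order_trans zero_le_power2 by blast

text \<open>A pointwise substitute for Pinsker's inequality: factor \<open>r - g\<close> as a
  difference of squares of roots and apply the arithmetic-geometric inequality with weight
  \<open>t\<close>. For probability densities, integration bounds the L1 distance by KL/(2t) +
  2t.\<close>

lemma abs_diff_le_kl:
  assumes "0 \<le> r" "0 < g" "0 < t"
  shows "\<bar>r - g\<bar> \<le> kl_integrand r g / (2 * t) + t * (r + g)"
proof -
  let ?a = "\<bar>sqrt r - sqrt g\<bar>" and ?b = "sqrt r + sqrt g"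
  have "r - g = (sqrt r - sqrt g) * ?b" using assms by (simp add: algebra_simps)
  then have rg: "\<bar>r - g\<bar> = ?a * ?b" using assms by (simp add: abs_mult)
  have "0 \<le> (?a - t * ?b)\<^sup>2" by simp
  then have "2 * t * (?a * ?b) \<le> ?a\<^sup>2 + t\<^sup>2 * ?b\<^sup>2" by (simp add: power2_diff power_mult_distrib mult_ac)
  also have "?a\<^sup>2 \<le> kl_integrand r g" using kl_integrand_ge_hellinger[OF assms(1,2)] by simp
  also have "?b\<^sup>2 \<le> 2 * (r + g)"
    using assms zero_le_power2[of "sqrt r - sqrt g"] by (simp add: power2_sum power2_diff)
  finally have "2 * t * \<bar>r - g\<bar> \<le> kl_integrand r g + t\<^sup>2 * (2 * (r + g))"
    unfolding rg by (simp add: mult_left_mono)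
  then show ?thesis using \<open>0 < t\<close> by (simp add: field_simps power2_eq_square)
qed

text \<open>The negative part of \<open>f\<close> is dominated by that of the integrable
  \<open>k\<close>, so the difference is never of the form \<infinity> - \<infinity>, even when the
  integral of \<open>h\<close> is infinite.\<close>

lemma nn_integral_pos_neg_parts:
  fixes f h k :: "'a \<Rightarrow> real"
  assumes [measurable]: "f \<in> borel_measurable M" "h \<in> borel_measurable M"
    and h: "\<And>x. 0 \<le> h x" and k: "integrable M k" and f: "\<And>x. f x = h x + k x"
  shows "enn2ereal (\<integral>\<^sup>+x. ennreal (f x) \<partial>M) - enn2ereal (\<integral>\<^sup>+x. ennreal (- f x) \<partial>M)
    = enn2ereal (\<integral>\<^sup>+x. ennreal (h x) \<partial>M) + ereal (\<integral>x. k x \<partial>M)"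
proof -
  have [measurable]: "k \<in> borel_measurable M" using k by simp
  let ?I = "\<lambda>g. \<integral>\<^sup>+x. ennreal (g x) \<partial>M"
  \<comment> \<open>Positive and negative parts are moved to the sides where they are added, since
    subtraction in \<open>ennreal\<close> is truncated.\<close>
  have "?I f + ?I (\<lambda>x. - k x) = (\<integral>\<^sup>+x. ennreal (f x) + ennreal (- k x) \<partial>M)"
    by (simp add: nn_integral_add)
  also have "\<dots> = (\<integral>\<^sup>+x. ennreal (h x) + ennreal (k x) + ennreal (- f x) \<partial>M)"
  proof (rule nn_integral_cong)
    fix x
    have "ennreal (f x) + ennreal (- k x) = ennreal (max 0 (f x) + max 0 (- k x))"
      by (simp add: ennreal_plus max_def ennreal_neg)
    also have "max 0 (f x) + max 0 (- k x) = h x + max 0 (k x) + max 0 (- f x)"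
      using h[of x] f[of x] by linarith
    also have "ennreal \<dots> = ennreal (h x) + ennreal (k x) + ennreal (- f x)"
      using h[of x] by (simp add: ennreal_plus max_def ennreal_neg)
    finally show "ennreal (f x) + ennreal (- k x) = ennreal (h x) + ennreal (k x) + ennreal (- f x)" .
  qed
  also have "\<dots> = ?I h + ?I k + ?I (\<lambda>x. - f x)" by (simp add: nn_integral_add)
  finally have eq: "?I f + ?I (\<lambda>x. - k x) = ?I h + ?I k + ?I (\<lambda>x. - f x)" .
  have K: "?I k \<noteq> \<infinity>" "?I (\<lambda>x. - k x) \<noteq> \<infinity>"
    using k by (simp_all add: real_integrable_def)
  have "?I (\<lambda>x. - f x) \<le> ?I (\<lambda>x. - k x)"
    using h f by (intro nn_integral_mono ennreal_leI) simp
  then have F: "?I (\<lambda>x. - f x) \<noteq> \<infinity>" using K(2) by (auto simp: top_unique)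
  obtain a where a: "?I k = ennreal a" "0 \<le> a" using K(1) by (cases "?I k") auto
  obtain b where b: "?I (\<lambda>x. - k x) = ennreal b" "0 \<le> b"
    using K(2) by (cases "?I (\<lambda>x. - k x)") auto
  obtain c where c: "?I (\<lambda>x. - f x) = ennreal c" "0 \<le> c"
    using F by (cases "?I (\<lambda>x. - f x)") auto
  note abc = a b c
  have int: "(\<integral>x. k x \<partial>M) = a - b"
    using abc by (simp add: real_lebesgue_integral_def[OF k])
  show ?thesis
  proof (cases "?I h")
    case (real u)
    then have "?I f + ennreal b = ennreal (u + a + c)"
      using eq abc by (simp add: ennreal_plus)
    then obtain v where v: "?I f = ennreal v" "0 \<le> v"
      by (cases "?I f") auto
    then have "v + b = u + a + c"
      using \<open>?I f + ennreal b = ennreal (u + a + c)\<close> real abc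
      by (simp add: ennreal_plus[symmetric] del: ennreal_plus)
    then show ?thesis using real v abc int by (simp add: enn2ereal_ennreal)
  next
    case top
    then have "?I f = \<top>" using eq abc by (cases "?I f") (auto simp: ennreal_plus[symmetric] simp del: ennreal_plus)
    then show ?thesis using top abc by (simp add: enn2ereal_ennreal)
  qed
qed

section \<open>Second moments and marginal densities\<close>

lemma second_moment_integrable:
  fixes P :: "(real^'n) measure"
  assumes "prob_space P" "sets P = sets borel" "integrable P (\<lambda>x. (norm x)\<^sup>2)"
  shows "integrable P (\<lambda>x. x)" "integrable P (\<lambda>x. x $ i)" "integrable P (\<lambda>x. x $ i * x $ j)"
proof -
  interpret prob_space P by fact
  note [measurable_cong] = assms(2)
  have "t \<le> \<bar>1 + t\<^sup>2\<bar>" if "0 \<le> t" for t :: real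
  proof -
    have "0 \<le> (t - 1)\<^sup>2" by simp
    then have "2 * t \<le> 1 + t\<^sup>2" by (simp add: power2_diff)
    then show ?thesis using that by linarith
  qed
  then have le: "norm x \<le> norm (1 + (norm x)\<^sup>2)" for x :: "real^'n"
    unfolding real_norm_def using norm_ge_zero by blast
  show 1: "integrable P (\<lambda>x. x)"
  proof (rule Bochner_Integration.integrable_bound)
    show "integrable P (\<lambda>x. 1 + (norm x)\<^sup>2)"
      by (intro Bochner_Integration.integrable_add assms(3) integrable_const)
    show "(\<lambda>x. x) \<in> borel_measurable P" by measurable
    show "AE x in P. norm x \<le> norm (1 + (norm x)\<^sup>2)" by (rule AE_I2) (rule le)
  qed
  show "integrable P (\<lambda>x. x $ i)"
    using integrable_bounded_linear[OF bounded_linear_vec_nth 1] .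
  have "\<bar>x $ i * x $ j\<bar> \<le> (norm x)\<^sup>2" for x :: "real^'n"
    using mult_mono[OF component_le_norm_cart[of x i] component_le_norm_cart[of x j]]
    by (simp add: abs_mult power2_eq_square)
  then show "integrable P (\<lambda>x. x $ i * x $ j)"
    by (intro Bochner_Integration.integrable_bound[OF assms(3)]) auto
qed

lemma centered_moments:
  fixes P :: "(real^'n) measure"
  assumes P: "prob_space P" "sets P = sets borel" "integrable P (\<lambda>x. (norm x)\<^sup>2)"
  defines "m \<equiv> mean_vec P"
  shows "integrable P (\<lambda>x. v \<bullet> (x - m))" "(\<integral>x. v \<bullet> (x - m) \<partial>P) = 0"
    "integrable P (\<lambda>x. (x - m) \<bullet> (A *v (x - m)))"
    "(\<integral>x. (x - m) \<bullet> (A *v (x - m)) \<partial>P) = trace (A ** cov_mat P)"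
proof -
  interpret prob_space P by fact
  note int = second_moment_integrable[OF P]
  have c: "integrable P (\<lambda>x. x $ i - m $ i)" "(\<integral>x. x $ i - m $ i \<partial>P) = 0" for i
    using int by (simp_all add: m_def mean_vec_component prob_space)
  have cc: "integrable P (\<lambda>x. (x $ i - m $ i) * (x $ j - m $ j))" for i j
    using int by (simp add: algebra_simps)
  show "integrable P (\<lambda>x. v \<bullet> (x - m))" "(\<integral>x. v \<bullet> (x - m) \<partial>P) = 0"
    unfolding inner_vec_def using c by (simp_all add: Bochner_Integration.integrable_sum
        Bochner_Integration.integral_sum)
  have q: "(x - m) \<bullet> (A *v (x - m)) = (\<Sum>i\<in>UNIV. \<Sum>j\<in>UNIV. A $ i $ j * ((x $ i - m $ i) * (x $ j - m $ j)))" for x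
    by (simp add: inner_vec_def matrix_vector_mult_def sum_distrib_left mult_ac)
  show "integrable P (\<lambda>x. (x - m) \<bullet> (A *v (x - m)))"
    unfolding q using cc by (intro Bochner_Integration.integrable_sum integrable_mult_right) auto
  have "(\<integral>x. (x - m) \<bullet> (A *v (x - m)) \<partial>P) = (\<Sum>i\<in>UNIV. \<Sum>j\<in>UNIV. A $ i $ j * cov_mat P $ i $ j)"
    unfolding q using cc by (simp add: Bochner_Integration.integral_sum Bochner_Integration.integrable_sum
        cov_mat_def m_def)
  also have "\<dots> = trace (A ** cov_mat P)"
  proof -
    have "cov_mat P $ i $ j = cov_mat P $ j $ i" for i j by (simp add: cov_mat_def mult.commute)
    then show ?thesis by (simp add: trace_def matrix_matrix_mult_def)
  qed
  finally show "(\<integral>x. (x - m) \<bullet> (A *v (x - m)) \<partial>P) = trace (A ** cov_mat P)" .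
qed

text \<open>Couplings carry \<open>borel\<close> of the product type; \<open>borel_prod\<close>
  identifies it with the product sigma-algebra.\<close>

lemma borel_measurable_fst_snd_euclidean [measurable]:
  "fst \<in> borel_measurable (borel :: ('a::euclidean_space \<times> 'b::euclidean_space) measure)"
  "snd \<in> borel_measurable (borel :: ('a::euclidean_space \<times> 'b::euclidean_space) measure)"
  by (simp_all add: borel_prod[symmetric])

lemma distr_fst_density_lborel:
  fixes f :: "'a::euclidean_space \<times> 'b::euclidean_space \<Rightarrow> ennreal"
  assumes f: "f \<in> borel_measurable borel"
  shows "distr (density lborel f) borel fst = density lborel (\<lambda>x. \<integral>\<^sup>+y. f (x, y) \<partial>lborel)"
proof (rule measure_eqI)
  have [measurable]: "f \<in> borel_measurable (borel \<Otimes>\<^sub>M borel)"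
    using f by (simp add: borel_prod)
  fix A :: "'a set" assume "A \<in> sets (distr (density lborel f) borel fst)"
  then have [measurable]: "A \<in> sets borel" by simp
  have "emeasure (distr (density lborel f) borel fst) A = (\<integral>\<^sup>+z. indicator A z \<partial>distr (density lborel f) borel fst)"
    by simp
  also have "\<dots> = (\<integral>\<^sup>+z. f z * indicator A (fst z) \<partial>(lborel \<Otimes>\<^sub>M lborel))"
    by (subst nn_integral_distr) (use f in \<open>simp_all add: nn_integral_density lborel_prod\<close>)
  also have "\<dots> = (\<integral>\<^sup>+x. \<integral>\<^sup>+y. f (x, y) * indicator A x \<partial>lborel \<partial>lborel)"
    by (subst lborel.nn_integral_fst[symmetric]) simp_all
  also have "\<dots> = emeasure (density lborel (\<lambda>x. \<integral>\<^sup>+y. f (x, y) \<partial>lborel)) A"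
    by (simp add: emeasure_density nn_integral_multc)
  finally show "emeasure (distr (density lborel f) borel fst) A
      = emeasure (density lborel (\<lambda>x. \<integral>\<^sup>+y. f (x, y) \<partial>lborel)) A" .
qed simp

lemma distr_snd_density_lborel:
  fixes f :: "'a::euclidean_space \<times> 'b::euclidean_space \<Rightarrow> ennreal"
  assumes f: "f \<in> borel_measurable borel"
  shows "distr (density lborel f) borel snd = density lborel (\<lambda>y. \<integral>\<^sup>+x. f (x, y) \<partial>lborel)"
proof (rule measure_eqI)
  have [measurable]: "f \<in> borel_measurable (borel \<Otimes>\<^sub>M borel)"
    using f by (simp add: borel_prod)
  fix A :: "'b set" assume "A \<in> sets (distr (density lborel f) borel snd)"
  then have [measurable]: "A \<in> sets borel" by simp
  have "emeasure (distr (density lborel f) borel snd) A = (\<integral>\<^sup>+z. indicator A z \<partial>distr (density lborel f) borel snd)"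
    by simp
  also have "\<dots> = (\<integral>\<^sup>+z. f z * indicator A (snd z) \<partial>(lborel \<Otimes>\<^sub>M lborel))"
    by (subst nn_integral_distr) (use f in \<open>simp_all add: nn_integral_density lborel_prod\<close>)
  also have "\<dots> = (\<integral>\<^sup>+y. \<integral>\<^sup>+x. f (x, y) * indicator A y \<partial>lborel \<partial>lborel)"
    by (subst lborel_pair.nn_integral_snd[symmetric]) simp_all
  also have "\<dots> = emeasure (density lborel (\<lambda>y. \<integral>\<^sup>+x. f (x, y) \<partial>lborel)) A"
    by (simp add: emeasure_density nn_integral_multc)
  finally show "emeasure (distr (density lborel f) borel snd) A
      = emeasure (density lborel (\<lambda>y. \<integral>\<^sup>+x. f (x, y) \<partial>lborel)) A" .
qed simp

subsection \<open>The reference coupling\<close>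

text \<open>\<open>entropy_H\<close> evaluates a density picked by \<open>SOME\<close>. The lemma
  returns that density, which may differ from \<open>r'\<close> on a null set.\<close>

lemma has_leb_density_entropy:
  assumes "has_leb_density \<pi> r'"
  obtains r where "has_leb_density \<pi> r"
    "entropy_H \<pi> = enn2ereal (\<integral>\<^sup>+ z. ennreal (r z * ln (r z)) \<partial>lborel)
        - enn2ereal (\<integral>\<^sup>+ z. ennreal (- (r z * ln (r z))) \<partial>lborel)"
proof
  show "has_leb_density \<pi> (SOME r. has_leb_density \<pi> r)"
    by (rule someI[of "has_leb_density \<pi>" r', OF assms])
qed (use assms in \<open>auto simp: entropy_H_def Let_def\<close>)

lemma ln_gaussian_pdf:
  fixes S :: "real^'n^'n"
  assumes "pos_def_mat S"
  shows "ln (gaussian_pdf m S x) = - (real CARD('n) / 2) * ln (2 * pi) - ln (det S) / 2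
    - (x - m) \<bullet> (matrix_inv S *v (x - m)) / 2"
  using pos_def_det_pos[OF assms]
  by (simp add: gaussian_pdf_def ln_mult ln_powr)

text \<open>The parameters hidden in the existential quantifiers can be recovered as the mean and
  covariance.\<close>

lemma is_gaussian_iff:
  fixes P :: "(real^'n) measure"
  assumes P: "prob_space P" "sets P = sets borel" "integrable P (\<lambda>x. (norm x)\<^sup>2)"
    and pd: "pos_def_mat (cov_mat P)"
  shows "is_gaussian P \<longleftrightarrow> P = gaussian_measure (mean_vec P) (cov_mat P)"
proof
  assume "is_gaussian P"
  then obtain m S where S: "pos_def_mat S" and Pg: "P = gaussian_measure m S"
    by (auto simp: is_gaussian_def gaussian_measure_def)
  have "integrable (gaussian_measure m S) (\<lambda>x. x)"
    using second_moment_integrable(1)[OF P] Pg by simp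
  then show "P = gaussian_measure (mean_vec P) (cov_mat P)"
    using gaussian_measure_mean[OF S] gaussian_measure_cov[OF S] Pg by simp
next
  assume "P = gaussian_measure (mean_vec P) (cov_mat P)"
  then show "is_gaussian P" using pd unfolding is_gaussian_def gaussian_measure_def by blast
qed

text \<open>From here on \<open>X\<close> is known through its positive definiteness and its
  equation; \<open>entropic_transport_matrix\<close> supplies both for the explicit formula.\<close>

locale entropic_transport =
  fixes P Q :: "(real^'n) measure" and \<epsilon> :: real and m1 m2 :: "real^'n" and S1 S2 X :: "real^'n^'n"
  assumes P: "prob_space P" "sets P = sets borel" "integrable P (\<lambda>x. (norm x)\<^sup>2)"
    and Q: "prob_space Q" "sets Q = sets borel" "integrable Q (\<lambda>x. (norm x)\<^sup>2)"
    and m1: "m1 = mean_vec P" and m2: "m2 = mean_vec Q"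
    and S1: "S1 = cov_mat P" and S2: "S2 = cov_mat Q"
    and pd: "pos_def_mat S1" "pos_def_mat S2" "pos_def_mat X"
    and \<epsilon>: "0 < \<epsilon>"
    and X: "X ** S1 ** X + (\<epsilon>/2) *\<^sub>R X = S2"
begin

definition bound :: real where
  "bound = (norm (m1 - m2))\<^sup>2 + trace S1 + trace S2 - 2 * trace (S1 ** X)
     - (\<epsilon>/2) * ln ((2 * pi * exp 1) ^ (2 * CARD('n)) * (\<epsilon>/2) ^ CARD('n) * det (S1 ** X))"

definition reference_pdf :: "(real^'n) \<times> (real^'n) \<Rightarrow> real" where
  "reference_pdf z = gaussian_pdf m1 S1 (fst z) *
     gaussian_pdf (m2 + X *v (fst z - m1)) ((\<epsilon>/2) *\<^sub>R X) (snd z)"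

definition reference :: "((real^'n) \<times> (real^'n)) measure" where
  "reference = density lborel (\<lambda>z. ennreal (reference_pdf z))"

definition transport_cost :: "((real^'n) \<times> (real^'n)) measure \<Rightarrow> ereal" where
  "transport_cost \<pi> = enn2ereal (\<integral>\<^sup>+ z. ennreal ((norm (fst z - snd z))\<^sup>2) \<partial>\<pi>) + ereal \<epsilon> * entropy_H \<pi>"

text \<open>Together with \<open>potential2\<close>, these are the Schroedinger potentials of the
  Gaussian problem: \<open>reference_pdf\<close> is exp((\<open>potential1\<close> +
  \<open>potential2\<close> + \<open>offset\<close> - |x - y|^2)/\<epsilon>). The linear parts come
  from the displacement of the means.\<close>

definition potential1 :: "real^'n \<Rightarrow> real" where
  "potential1 x = (x - m1) \<bullet> ((mat 1 - (\<epsilon>/2) *\<^sub>R matrix_inv S1 - X) *v (x - m1))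
     + (2 *\<^sub>R (m1 - m2)) \<bullet> (x - m1)"

definition potential2 :: "real^'n \<Rightarrow> real" where
  "potential2 y = (y - m2) \<bullet> ((mat 1 - matrix_inv X) *v (y - m2)) - (2 *\<^sub>R (m1 - m2)) \<bullet> (y - m2)"

definition offset :: real where
  "offset = (norm (m1 - m2))\<^sup>2
     - (\<epsilon>/2) * (2 * real CARD('n) * ln (2 * pi) + ln (det S1) + ln (det ((\<epsilon>/2) *\<^sub>R X)))"

lemma pd_cond: "pos_def_mat ((\<epsilon>/2) *\<^sub>R X)"
  using \<epsilon> by (intro pos_def_scaleR pd) simp

lemma reference_pdf_pos: "0 < reference_pdf z"
  by (simp add: reference_pdf_def gaussian_pdf_pos pd pd_cond)

lemma reference_pdf_measurable [measurable]: "reference_pdf \<in> borel_measurable borel"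
  unfolding reference_pdf_def gaussian_pdf_def by measurable

lemma cost_plus_log_reference:
  "(norm (x - y))\<^sup>2 + \<epsilon> * ln (reference_pdf (x, y)) = potential1 x + potential2 y + offset"
proof -
  define u where "u = x - m1"
  define v where "v = y - m2"
  define \<delta> where "\<delta> = m1 - m2"
  have xy: "x - y = u - v + \<delta>" by (simp add: u_def v_def \<delta>_def)
  have yv: "y - (m2 + X *v (x - m1)) = v - X *v u" by (simp add: u_def v_def)
  have "ln (reference_pdf (x, y)) = ln (gaussian_pdf m1 S1 x)
      + ln (gaussian_pdf (m2 + X *v (x - m1)) ((\<epsilon>/2) *\<^sub>R X) y)"
    using gaussian_pdf_pos[OF pd(1)] gaussian_pdf_pos[OF pd_cond]
    by (simp add: reference_pdf_def ln_mult_pos)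
  also have "\<dots> = - (real CARD('n) * ln (2 * pi)) - (ln (det S1) + ln (det ((\<epsilon>/2) *\<^sub>R X))) / 2
      - (u \<bullet> (matrix_inv S1 *v u)
         + (2/\<epsilon>) * (v \<bullet> (matrix_inv X *v v) - 2 * (u \<bullet> v) + u \<bullet> (X *v u))) / 2"
    unfolding ln_gaussian_pdf[OF pd(1)] ln_gaussian_pdf[OF pd_cond] yv
    unfolding conditional_form[OF pd \<epsilon> X refl] u_def[symmetric]
    by (simp add: add_divide_distrib diff_divide_distrib)
  finally have main: "ln (reference_pdf (x, y)) = \<dots>" .
  have ln: "\<epsilon> * ln (reference_pdf (x, y)) =
      - (\<epsilon>/2) * (2 * real CARD('n) * ln (2 * pi) + ln (det S1) + ln (det ((\<epsilon>/2) *\<^sub>R X)))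
      - (\<epsilon>/2) * (u \<bullet> (matrix_inv S1 *v u)) - (v \<bullet> (matrix_inv X *v v) - 2 * (u \<bullet> v) + u \<bullet> (X *v u))"
  proof -
    have cancel: "\<epsilon> * ((2/\<epsilon>) * t / 2) = t" for t using \<epsilon> by simp
    show ?thesis
      unfolding main right_diff_distrib distrib_left add_divide_distrib diff_divide_distrib cancel
      using \<epsilon> by (simp add: algebra_simps)
  qed
  \<comment> \<open>The term \<open>- 2 * (u \<bullet> v)\<close> here meets its opposite in
    \<open>ln\<close>; these are the only mixed terms.\<close>
  have norm: "(norm (x - y))\<^sup>2 = u \<bullet> u + v \<bullet> v - 2 * (u \<bullet> v) + (norm \<delta>)\<^sup>2 + 2 * (\<delta> \<bullet> u) - 2 * (\<delta> \<bullet> v)"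
    unfolding xy power2_norm_eq_inner
    by (simp add: inner_add_left inner_add_right inner_diff_left inner_diff_right inner_commute algebra_simps)
  have p1: "potential1 x = u \<bullet> u - (\<epsilon>/2) * (u \<bullet> (matrix_inv S1 *v u)) - u \<bullet> (X *v u) + 2 * (\<delta> \<bullet> u)"
    unfolding potential1_def u_def[symmetric] \<delta>_def[symmetric]
    by (simp add: matrix_vector_mult_diff_rdistrib inner_diff_right scaleR_matrix_vector_assoc[symmetric])
  have p2: "potential2 y = v \<bullet> v - v \<bullet> (matrix_inv X *v v) - 2 * (\<delta> \<bullet> v)"
    unfolding potential2_def v_def[symmetric] \<delta>_def[symmetric]
    by (simp add: matrix_vector_mult_diff_rdistrib inner_diff_right)
  show ?thesis
    unfolding ln norm p1 p2 offset_def \<delta>_def[symmetric] by algebra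
qed

lemma potential1_integral:
  "integrable P potential1"
  "(\<integral>x. potential1 x \<partial>P) = trace S1 - (\<epsilon>/2) * real CARD('n) - trace (S1 ** X)"
proof -
  note c = centered_moments[OF P, folded m1 S1]
  show "integrable P potential1"
    unfolding potential1_def by (intro Bochner_Integration.integrable_add c)
  have "(\<integral>x. potential1 x \<partial>P) = trace ((mat 1 - (\<epsilon>/2) *\<^sub>R matrix_inv S1 - X) ** S1)"
    unfolding potential1_def by (subst Bochner_Integration.integral_add) (simp_all only: c add_0_right)
  also have "\<dots> = trace S1 - (\<epsilon>/2) * real CARD('n) - trace (X ** S1)"
    by (simp add: matrix_diff_rdistrib matrix_mul_scaleR_left pos_def_matrix_inv[OF pd(1)] trace_sub
        trace_scaleR trace_I)
  finally show "(\<integral>x. potential1 x \<partial>P) = trace S1 - (\<epsilon>/2) * real CARD('n) - trace (S1 ** X)"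
    by (simp only: trace_mul_sym[of X S1])
qed

lemma potential2_integral:
  "integrable Q potential2"
  "(\<integral>y. potential2 y \<partial>Q) = trace S2 - (\<epsilon>/2) * real CARD('n) - trace (S1 ** X)"
proof -
  note c = centered_moments[OF Q, folded m2 S2]
  show "integrable Q potential2"
    unfolding potential2_def by (intro Bochner_Integration.integrable_diff c)
  \<comment> \<open>Multiplying the equation by the inverse of \<open>X\<close> expresses this trace
    through \<open>S1 ** X\<close>, so each potential contributes one of the two copies of
    \<open>trace (S1 ** X)\<close> in the bound.\<close>
  have "matrix_inv X ** S2 = (matrix_inv X ** X) ** S1 ** X + (\<epsilon>/2) *\<^sub>R (matrix_inv X ** X)"
    unfolding X[symmetric] by (simp add: matrix_add_ldistrib matrix_mul_scaleR_right matrix_mul_assoc)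
  then have XS2: "matrix_inv X ** S2 = S1 ** X + (\<epsilon>/2) *\<^sub>R mat 1"
    by (simp add: pos_def_matrix_inv[OF pd(3)])
  have "(\<integral>y. potential2 y \<partial>Q) = trace ((mat 1 - matrix_inv X) ** S2)"
    unfolding potential2_def by (subst Bochner_Integration.integral_diff) (simp_all only: c diff_0_right)
  also have "\<dots> = trace S2 - (\<epsilon>/2) * real CARD('n) - trace (S1 ** X)"
    by (simp add: matrix_diff_rdistrib XS2 trace_sub trace_add trace_scaleR trace_I)
  finally show "(\<integral>y. potential2 y \<partial>Q) = trace S2 - (\<epsilon>/2) * real CARD('n) - trace (S1 ** X)" .
qed

text \<open>The two traces contribute -(\<epsilon>/2) times twice the dimension; absorbed into the
  logarithm, they turn the powers of 2 pi from the normalising constants into powers of 2 pi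
  e.\<close>

lemma bound_eq: "(\<integral>x. potential1 x \<partial>P) + (\<integral>y. potential2 y \<partial>Q) + offset = bound"
proof -
  have pos: "0 < det S1" "0 < det X" "0 < \<epsilon>/2"
    using pos_def_det_pos pd \<epsilon> by auto
  have "ln ((2 * pi * exp 1) ^ (2 * CARD('n)) * (\<epsilon>/2) ^ CARD('n) * det (S1 ** X))
      = ln ((2 * pi * exp 1) ^ (2 * CARD('n))) + ln (det S1) + ln ((\<epsilon>/2) ^ CARD('n) * det X)"
    using pos by (simp add: det_mul ln_mult_pos)
  also have "ln ((2 * pi * exp 1) ^ (2 * CARD('n))) = 2 * real CARD('n) * (ln (2 * pi) + 1)"
    by (simp add: ln_realpow ln_mult_pos)
  finally show ?thesis
    unfolding potential1_integral potential2_integral bound_def offset_def det_scaleR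
    by (simp add: algebra_simps)
qed

lemma reference_fst: "distr reference borel fst = gaussian_measure m1 S1"
proof -
  have "(\<integral>\<^sup>+y. ennreal (reference_pdf (x, y)) \<partial>lborel) = ennreal (gaussian_pdf m1 S1 x)" for x
    using gaussian_pdf_pos[OF pd(1), of m1 x] gaussian_pdf_pos[OF pd_cond]
    by (simp add: reference_pdf_def ennreal_mult less_imp_le nn_integral_cmult nn_integral_gaussian_pdf[OF pd_cond])
  then show ?thesis
    unfolding reference_def gaussian_measure_def by (subst distr_fst_density_lborel) simp_all
qed

lemma reference_snd: "distr reference borel snd = gaussian_measure m2 S2"
proof -
  define K where "K = matrix_inv S1 + (2/\<epsilon>) *\<^sub>R X"
  have K: "pos_def_mat (matrix_inv K)" by (intro pos_def_inverse pos_def_K[OF pd \<epsilon> X K_def])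
  have "(\<integral>\<^sup>+x. ennreal (reference_pdf (x, y)) \<partial>lborel) = ennreal (gaussian_pdf m2 S2 y)" for y
    using gaussian_pdf_pos[OF pd(2), of m2 y] gaussian_pdf_pos[OF K]
    by (simp add: reference_pdf_def gaussian_pdf_factor[OF pd \<epsilon> X K_def] ennreal_mult less_imp_le
        nn_integral_cmult nn_integral_gaussian_pdf[OF K])
  then show ?thesis
    unfolding reference_def gaussian_measure_def by (subst distr_snd_density_lborel) simp_all
qed

lemma sets_reference [simp, measurable_cong]: "sets reference = sets borel"
  by (simp add: reference_def)

lemma prob_space_reference: "prob_space reference"
proof
  interpret G: prob_space "gaussian_measure m1 S1" by (rule prob_space_gaussian_measure[OF pd(1)])
  have sp: "space (gaussian_measure m1 S1) = UNIV" "space reference = UNIV"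
    by (simp_all add: gaussian_measure_def reference_def)
  have "emeasure (distr reference borel fst) UNIV = emeasure reference UNIV"
    by (subst emeasure_distr) (auto simp: reference_def)
  then show "emeasure reference (space reference) = 1"
    using G.emeasure_space_1 by (simp only: reference_fst sp)
qed

lemma has_leb_density_reference: "has_leb_density reference reference_pdf"
  using reference_pdf_pos by (simp add: has_leb_density_def reference_def less_imp_le)

lemma nn_integral_reference_pdf: "(\<integral>\<^sup>+z. ennreal (reference_pdf z) \<partial>lborel) = 1"
  using prob_space.emeasure_space_1[OF prob_space_reference]
  by (simp add: reference_def emeasure_density)

section \<open>The cost of a single coupling\<close>

context
  fixes \<pi>
  assumes \<pi>: "\<pi> \<in> couplings P Q"
begin

lemma coupling_measurable [measurable_cong]: "sets \<pi> = sets borel"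
  using \<pi> by (simp add: couplings_def)

lemma coupling_integral_fst:
  fixes f :: "real^'n \<Rightarrow> real"
  assumes "integrable P f"
  shows "integrable \<pi> (\<lambda>z. f (fst z))" "(\<integral>z. f (fst z) \<partial>\<pi>) = (\<integral>x. f x \<partial>P)"
proof -
  have d: "distr \<pi> borel fst = P" using \<pi> by (simp add: couplings_def)
  have [measurable]: "f \<in> borel_measurable borel" using assms P(2) by (auto dest!: borel_measurable_integrable cong: measurable_cong_sets)
  show "integrable \<pi> (\<lambda>z. f (fst z))"
    using assms unfolding d[symmetric] by (subst (asm) integrable_distr_eq) simp_all
  show "(\<integral>z. f (fst z) \<partial>\<pi>) = (\<integral>x. f x \<partial>P)"
    unfolding d[symmetric] by (subst integral_distr) simp_all
qed

lemma coupling_integral_snd: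
  fixes f :: "real^'n \<Rightarrow> real"
  assumes "integrable Q f"
  shows "integrable \<pi> (\<lambda>z. f (snd z))" "(\<integral>z. f (snd z) \<partial>\<pi>) = (\<integral>y. f y \<partial>Q)"
proof -
  have d: "distr \<pi> borel snd = Q" using \<pi> by (simp add: couplings_def)
  have [measurable]: "f \<in> borel_measurable borel" using assms Q(2) by (auto dest!: borel_measurable_integrable cong: measurable_cong_sets)
  show "integrable \<pi> (\<lambda>z. f (snd z))"
    using assms unfolding d[symmetric] by (subst (asm) integrable_distr_eq) simp_all
  show "(\<integral>z. f (snd z) \<partial>\<pi>) = (\<integral>y. f y \<partial>Q)"
    unfolding d[symmetric] by (subst integral_distr) simp_all
qed

lemma coupling_cost_integrable: "integrable \<pi> (\<lambda>z. (norm (fst z - snd z))\<^sup>2)"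
proof (rule Bochner_Integration.integrable_bound)
  show "integrable \<pi> (\<lambda>z. 2 * (norm (fst z))\<^sup>2 + 2 * (norm (snd z))\<^sup>2)"
    using coupling_integral_fst(1)[OF P(3)] coupling_integral_snd(1)[OF Q(3)] by simp
  have "(norm (x - y))\<^sup>2 \<le> 2 * (norm x)\<^sup>2 + 2 * (norm y)\<^sup>2" for x y :: "real^'n"
  proof -
    have "0 \<le> (norm (x + y))\<^sup>2" by simp
    then show ?thesis
      unfolding power2_norm_eq_inner
      by (simp add: inner_add_left inner_add_right inner_diff_left inner_diff_right inner_commute)
  qed
  then show "AE z in \<pi>. norm ((norm (fst z - snd z))\<^sup>2) \<le> norm (2 * (norm (fst z))\<^sup>2 + 2 * (norm (snd z))\<^sup>2)"
    by (intro AE_I2) simp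
  show "(\<lambda>z. (norm (fst z - snd z))\<^sup>2) \<in> borel_measurable \<pi>" by measurable
qed

lemma log_reference_integral:
  "integrable \<pi> (\<lambda>z. ln (reference_pdf z))"
  "(\<integral>z. (norm (fst z - snd z))\<^sup>2 \<partial>\<pi>) + \<epsilon> * (\<integral>z. ln (reference_pdf z) \<partial>\<pi>) = bound"
proof -
  interpret prob_space \<pi> using \<pi> by (simp add: couplings_def)
  note int = coupling_integral_fst[OF potential1_integral(1)] coupling_integral_snd[OF potential2_integral(1)]
    coupling_cost_integrable
  \<comment> \<open>Solving the cost identity for the logarithm shows it to be a combination of
    integrable functions.\<close>
  have ln: "ln (reference_pdf z) = (1/\<epsilon>) *
      (potential1 (fst z) + potential2 (snd z) + offset - (norm (fst z - snd z))\<^sup>2)" for z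
    using cost_plus_log_reference[of "fst z" "snd z"] \<epsilon> by (simp add: field_simps)
  show i: "integrable \<pi> (\<lambda>z. ln (reference_pdf z))"
    unfolding ln using int by simp
  have "(\<integral>z. (norm (fst z - snd z))\<^sup>2 \<partial>\<pi>) + \<epsilon> * (\<integral>z. ln (reference_pdf z) \<partial>\<pi>)
      = (\<integral>z. (norm (fst z - snd z))\<^sup>2 + \<epsilon> * ln (reference_pdf z) \<partial>\<pi>)"
    using int i by simp
  also have "\<dots> = (\<integral>z. potential1 (fst z) + potential2 (snd z) + offset \<partial>\<pi>)"
    by (rule Bochner_Integration.integral_cong)
      (use cost_plus_log_reference in \<open>auto simp: prod_eq_iff split: prod.split\<close>)
  also have "\<dots> = bound"
    using int by (simp add: prob_space bound_eq)
  finally show "(\<integral>z. (norm (fst z - snd z))\<^sup>2 \<partial>\<pi>) + \<epsilon> * (\<integral>z. ln (reference_pdf z) \<partial>\<pi>) = bound" .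
qed

lemma transport_cost_eq:
  assumes "has_leb_density \<pi> r'"
  obtains r where "has_leb_density \<pi> r"
    "transport_cost \<pi> = ereal bound
      + ereal \<epsilon> * enn2ereal (\<integral>\<^sup>+z. ennreal (kl_integrand (r z) (reference_pdf z)) \<partial>lborel)"
proof -
  obtain r where r: "has_leb_density \<pi> r"
    and H: "entropy_H \<pi> = enn2ereal (\<integral>\<^sup>+ z. ennreal (r z * ln (r z)) \<partial>lborel)
        - enn2ereal (\<integral>\<^sup>+ z. ennreal (- (r z * ln (r z))) \<partial>lborel)"
    using has_leb_density_entropy[OF assms] .
  have [measurable]: "r \<in> borel_measurable borel" and r0: "\<And>z. 0 \<le> r z"
    and dens: "\<pi> = density lborel (\<lambda>z. ennreal (r z))"
    using r by (auto simp: has_leb_density_def)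
  interpret prob_space \<pi> using \<pi> by (simp add: couplings_def)
  let ?g = reference_pdf
  let ?kl = "\<integral>\<^sup>+z. ennreal (kl_integrand (r z) (?g z)) \<partial>lborel"
  let ?L = "\<integral>z. ln (?g z) \<partial>\<pi>"
  have "(\<integral>\<^sup>+z. ennreal (r z) \<partial>lborel) = 1"
    using emeasure_space_1 by (simp add: dens emeasure_density)
  then have ri: "integrable lborel r" "(\<integral>z. r z \<partial>lborel) = 1"
    using r0 by (auto simp: integral_eq_nn_integral intro!: integrableI_nonneg)
  have gi: "integrable lborel ?g" "(\<integral>z. ?g z \<partial>lborel) = 1"
    using nn_integral_reference_pdf reference_pdf_pos
    by (auto simp: integral_eq_nn_integral less_imp_le intro!: integrableI_nonneg)
  have Li: "integrable lborel (\<lambda>z. r z * ln (?g z))" "(\<integral>z. r z * ln (?g z) \<partial>lborel) = ?L"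
  proof -
    have "integrable (density lborel (\<lambda>z. ennreal (r z))) (\<lambda>z. ln (?g z))"
      using log_reference_integral(1) dens by simp
    then show "integrable lborel (\<lambda>z. r z * ln (?g z))"
      by (subst (asm) integrable_density) (auto simp: r0)
    show "(\<integral>z. r z * ln (?g z) \<partial>lborel) = ?L"
      unfolding dens by (subst integral_density) (auto simp: r0)
  qed
  \<comment> \<open>The bracket is integrable and \<open>r - g\<close> has integral 0, so the
    entropy is KL plus the integral of \<open>ln g\<close> against \<open>\<pi>\<close>. At zeros of
    \<open>r\<close> the identity rests on the factor 0 in front of the logarithm.\<close>
  have split: "r z * ln (r z) = kl_integrand (r z) (?g z) + (r z * ln (?g z) + r z - ?g z)" for z
    using r0[of z] reference_pdf_pos[of z]
    by (cases "r z = 0") (simp_all add: kl_integrand_def ln_div algebra_simps)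
  have "entropy_H \<pi> = enn2ereal ?kl + ereal (\<integral>z. r z * ln (?g z) + r z - ?g z \<partial>lborel)"
    unfolding H
  proof (rule nn_integral_pos_neg_parts)
    show "integrable lborel (\<lambda>z. r z * ln (?g z) + r z - ?g z)"
      by (intro Bochner_Integration.integrable_diff Bochner_Integration.integrable_add Li ri gi)
    show "0 \<le> kl_integrand (r z) (?g z)" for z by (intro kl_integrand_nonneg r0 reference_pdf_pos)
  qed (use split in \<open>simp_all add: kl_integrand_def\<close>)
  also have "(\<integral>z. r z * ln (?g z) + r z - ?g z \<partial>lborel) = ?L"
    using Li ri gi by simp
  finally have H': "entropy_H \<pi> = enn2ereal ?kl + ereal ?L" .
  have "(\<integral>\<^sup>+z. ennreal ((norm (fst z - snd z))\<^sup>2) \<partial>\<pi>) = ennreal (\<integral>z. (norm (fst z - snd z))\<^sup>2 \<partial>\<pi>)"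
    by (intro nn_integral_eq_integral coupling_cost_integrable) simp
  then have "transport_cost \<pi> = ereal (\<integral>z. (norm (fst z - snd z))\<^sup>2 \<partial>\<pi>)
      + ereal \<epsilon> * (enn2ereal ?kl + ereal ?L)"
    by (simp add: transport_cost_def H' enn2ereal_ennreal)
  also have "\<dots> = ereal bound + ereal \<epsilon> * enn2ereal ?kl"
    unfolding log_reference_integral(2)[symmetric] using \<epsilon> by (cases "enn2ereal ?kl") (auto simp: algebra_simps)
  finally show thesis using that r by blast
qed

lemma transport_cost_no_density:
  assumes "\<nexists>r. has_leb_density \<pi> r"
  shows "transport_cost \<pi> = \<infinity>"
  using assms \<epsilon> by (simp add: transport_cost_def entropy_H_def)

lemma transport_cost_ge: "ereal bound \<le> transport_cost \<pi>"
proof (cases "\<exists>r. has_leb_density \<pi> r")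
  case True
  then obtain r' where r': "has_leb_density \<pi> r'" by blast
  obtain r where "has_leb_density \<pi> r" "transport_cost \<pi> = ereal bound
      + ereal \<epsilon> * enn2ereal (\<integral>\<^sup>+z. ennreal (kl_integrand (r z) (reference_pdf z)) \<partial>lborel)"
    using transport_cost_eq[OF r'] .
  then show ?thesis using \<epsilon> by (simp add: ereal_le_add_self)
next
  case False
  then show ?thesis by (simp add: transport_cost_no_density)
qed

text \<open>The hypothesis means KL below \<open>t\<^sup>2\<close>, so \<open>abs_diff_le_kl\<close>
  with the same \<open>t\<close> bounds the L1 distance of the densities by t/2 + 2t, rounded up to
  3t.\<close>

lemma total_variation_le:
  assumes "0 < t" "transport_cost \<pi> < ereal (bound + \<epsilon> * t\<^sup>2)" "A \<in> sets borel"
  shows "\<bar>measure \<pi> A - measure reference A\<bar> \<le> 3 * t"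
proof -
  interpret p: prob_space \<pi> using \<pi> by (simp add: couplings_def)
  interpret g: prob_space reference by (rule prob_space_reference)
  note [measurable] = assms(3)
  have "\<exists>r. has_leb_density \<pi> r" using assms(2) transport_cost_no_density by force
  then obtain r' where r': "has_leb_density \<pi> r'" by blast
  obtain r where r: "has_leb_density \<pi> r"
    and cost: "transport_cost \<pi> = ereal bound
      + ereal \<epsilon> * enn2ereal (\<integral>\<^sup>+z. ennreal (kl_integrand (r z) (reference_pdf z)) \<partial>lborel)"
    using transport_cost_eq[OF r'] .
  have [measurable]: "r \<in> borel_measurable borel" and r0: "\<And>z. 0 \<le> r z"
    and dens: "\<pi> = density lborel (\<lambda>z. ennreal (r z))"
    using r by (auto simp: has_leb_density_def)
  let ?g = reference_pdf
  let ?kl = "\<integral>\<^sup>+z. ennreal (kl_integrand (r z) (?g z)) \<partial>lborel"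
  let ?D = "\<integral>\<^sup>+z. ennreal \<bar>r z - ?g z\<bar> \<partial>lborel"
  have g0: "0 \<le> ?g z" for z using reference_pdf_pos[of z] by simp
  have kl0: "0 \<le> kl_integrand (r z) (?g z)" for z by (intro kl_integrand_nonneg r0 reference_pdf_pos)
  have [measurable]: "(\<lambda>z. kl_integrand (r z) (?g z)) \<in> borel_measurable borel"
    unfolding kl_integrand_def by measurable
  have rint: "(\<integral>\<^sup>+z. ennreal (r z) \<partial>lborel) = 1"
    using p.emeasure_space_1 by (simp add: dens emeasure_density)
  obtain h where h: "?kl = ennreal h" "0 \<le> h" "h \<le> t\<^sup>2"
  proof (cases ?kl)
    case (real h)
    then have "\<epsilon> * h < \<epsilon> * t\<^sup>2" using cost assms(2) by (simp add: enn2ereal_ennreal)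
    then show thesis using that real \<epsilon> by (simp add: less_imp_le)
  next
    case top
    then show thesis using cost assms(2) \<epsilon> by simp
  qed
  have "?D \<le> (\<integral>\<^sup>+z. ennreal (1 / (2 * t)) * ennreal (kl_integrand (r z) (?g z))
      + ennreal t * (ennreal (r z) + ennreal (?g z)) \<partial>lborel)"
  proof (rule nn_integral_mono)
    fix z
    have "ennreal \<bar>r z - ?g z\<bar> \<le> ennreal (1 / (2 * t) * kl_integrand (r z) (?g z) + t * (r z + ?g z))"
      using abs_diff_le_kl[OF r0 reference_pdf_pos assms(1)] by (intro ennreal_leI) (simp add: field_simps)
    also have "\<dots> = ennreal (1 / (2 * t)) * ennreal (kl_integrand (r z) (?g z))
      + ennreal t * (ennreal (r z) + ennreal (?g z))"
      using r0[of z] g0[of z] kl0[of z] assms(1)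
      by (simp add: ennreal_plus ennreal_mult[symmetric] ennreal_plus[symmetric] del: ennreal_plus)
    finally show "ennreal \<bar>r z - ?g z\<bar> \<le> \<dots>" .
  qed
  also have "\<dots> = ennreal (1 / (2 * t)) * ennreal h + ennreal t * (1 + 1)"
    by (simp add: nn_integral_add nn_integral_cmult h(1) rint nn_integral_reference_pdf)
  also have "\<dots> = ennreal (h / (2 * t) + 2 * t)"
    using h assms(1) by (simp add: ennreal_mult[symmetric] ennreal_plus[symmetric] mult.commute del: ennreal_plus
        flip: ennreal_numeral ennreal_1)
  also have "\<dots> \<le> ennreal (3 * t)"
    using h assms(1) by (intro ennreal_leI) (simp add: field_simps power2_eq_square)
  finally have D: "?D \<le> ennreal (3 * t)" .
  \<comment> \<open>The L1 distance bounds the difference on every set, here as two one-sided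
    estimates so that no subtraction occurs in \<open>ennreal\<close>.\<close>
  have "emeasure \<pi> A = (\<integral>\<^sup>+z. ennreal (r z) * indicator A z \<partial>lborel)"
    unfolding dens by (rule emeasure_density) auto
  also have "\<dots> \<le> (\<integral>\<^sup>+z. ennreal (?g z) * indicator A z + ennreal \<bar>r z - ?g z\<bar> \<partial>lborel)"
    using r0 g0 by (intro nn_integral_mono)
      (auto simp: indicator_def ennreal_plus[symmetric] simp del: ennreal_plus intro!: ennreal_leI)
  also have "\<dots> = emeasure reference A + ?D"
    by (simp add: nn_integral_add reference_def emeasure_density)
  also have "\<dots> \<le> emeasure reference A + ennreal (3 * t)" by (intro add_left_mono D)
  finally have 1: "measure \<pi> A \<le> measure reference A + 3 * t"
    using assms(1)
    by (simp add: p.emeasure_eq_measure g.emeasure_eq_measure ennreal_plus[symmetric] del: ennreal_plus)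
  have "emeasure reference A = (\<integral>\<^sup>+z. ennreal (?g z) * indicator A z \<partial>lborel)"
    unfolding reference_def by (rule emeasure_density) auto
  also have "\<dots> \<le> (\<integral>\<^sup>+z. ennreal (r z) * indicator A z + ennreal \<bar>r z - ?g z\<bar> \<partial>lborel)"
    using r0 g0 by (intro nn_integral_mono)
      (auto simp: indicator_def ennreal_plus[symmetric] simp del: ennreal_plus intro!: ennreal_leI)
  also have "\<dots> = emeasure \<pi> A + ?D"
    by (simp add: nn_integral_add emeasure_density dens)
  also have "\<dots> \<le> emeasure \<pi> A + ennreal (3 * t)" by (intro add_left_mono D)
  finally have 2: "measure reference A \<le> measure \<pi> A + 3 * t"
    using assms(1)
    by (simp add: p.emeasure_eq_measure g.emeasure_eq_measure ennreal_plus[symmetric] del: ennreal_plus)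
  from 1 2 show ?thesis by (simp add: abs_le_iff)
qed

end

section \<open>The infimum over couplings and the equality case\<close>

lemma entropic_W2_eq_INF: "entropic_W2 \<epsilon> P Q = (INF \<pi>\<in>couplings P Q. transport_cost \<pi>)"
  by (simp add: entropic_W2_def transport_cost_def)

lemma entropic_W2_ge: "ereal bound \<le> entropic_W2 \<epsilon> P Q"
  unfolding entropic_W2_eq_INF by (intro INF_greatest transport_cost_ge)

text \<open>No minimiser is needed: couplings whose cost approaches the bound converge to the reference
  measure in total variation, while their marginals stay fixed.\<close>
lemma marginal_eq_reference:
  fixes p :: "(real^'n) \<times> (real^'n) \<Rightarrow> real^'n"
  assumes eq: "entropic_W2 \<epsilon> P Q = ereal bound" and p: "p \<in> borel_measurable borel"
    and R: "prob_space R" "sets R = sets borel"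
    and marg: "\<And>\<pi>. \<pi> \<in> couplings P Q \<Longrightarrow> distr \<pi> borel p = R"
  shows "R = distr reference borel p"
proof (rule measure_eqI)
  interpret R: prob_space R by fact
  interpret g: prob_space reference by (rule prob_space_reference)
  interpret d: prob_space "distr reference borel p" 
    using p by (intro g.prob_space_distr) (simp cong: measurable_cong_sets)
  fix B assume "B \<in> sets R"
  then have B: "B \<in> sets borel" by (simp add: R)
  have pB: "p -` B \<in> sets borel" using measurable_sets[OF p B] by simp
  have "\<bar>measure R B - measure reference (p -` B)\<bar> \<le> 0 + t" if "0 < t" for t
  proof -
    \<comment> \<open>An excess below \<epsilon> (t/3)^2 makes the total variation estimate, with
      its factor 3, come out as \<open>t\<close>.\<close>
    have "(INF \<pi>\<in>couplings P Q. transport_cost \<pi>) < ereal (bound + \<epsilon> * (t / 3)\<^sup>2)"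
      using eq \<epsilon> that by (simp add: entropic_W2_eq_INF)
    then obtain \<pi> where \<pi>: "\<pi> \<in> couplings P Q" "transport_cost \<pi> < ereal (bound + \<epsilon> * (t / 3)\<^sup>2)"
      by (auto simp: INF_less_iff)
    have sp: "sets \<pi> = sets borel" using \<pi>(1) by (simp add: couplings_def)
    then have "space \<pi> = UNIV" using sets_eq_imp_space_eq[OF sp] by simp
    then have "measure R B = measure \<pi> (p -` B)"
      unfolding marg[OF \<pi>(1), symmetric] using p B sp
      by (subst measure_distr) (auto cong: measurable_cong_sets)
    then show ?thesis using total_variation_le[OF \<pi>(1) _ \<pi>(2) pB] that by simp
  qed
  then have "\<bar>measure R B - measure reference (p -` B)\<bar> \<le> 0" by (rule field_le_epsilon)
  moreover have "measure (distr reference borel p) B = measure reference (p -` B)"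
    using p B by (subst measure_distr) (auto simp: reference_def)
  ultimately have "measure R B = measure (distr reference borel p) B" by simp
  then show "emeasure R B = emeasure (distr reference borel p) B"
    by (simp add: R.emeasure_eq_measure d.emeasure_eq_measure)
qed (simp add: R)

text \<open>Under equality the marginals agree with those of \<open>reference\<close>, which are
  Gaussian. Conversely, for Gaussian \<open>P\<close> and \<open>Q\<close> the measure
  \<open>reference\<close> is itself a coupling and has zero relative entropy, so it attains the
  bound.\<close>

lemma entropic_W2_eq_bound_iff:
  "entropic_W2 \<epsilon> P Q = ereal bound \<longleftrightarrow> is_gaussian P \<and> is_gaussian Q"
proof
  assume eq: "entropic_W2 \<epsilon> P Q = ereal bound"
  have "P = distr reference borel fst"
    by (rule marginal_eq_reference[OF eq _ P(1,2)]) (auto simp: couplings_def)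
  moreover have "Q = distr reference borel snd"
    by (rule marginal_eq_reference[OF eq _ Q(1,2)]) (auto simp: couplings_def)
  ultimately show "is_gaussian P \<and> is_gaussian Q"
    unfolding reference_fst reference_snd is_gaussian_def gaussian_measure_def using pd by blast
next
  assume "is_gaussian P \<and> is_gaussian Q"
  then have "P = gaussian_measure m1 S1" "Q = gaussian_measure m2 S2"
    using is_gaussian_iff[OF P] is_gaussian_iff[OF Q] pd by (simp_all add: m1 m2 S1 S2)
  then have ref: "reference \<in> couplings P Q"
    by (simp add: couplings_def prob_space_reference reference_fst reference_snd)
  obtain r where r: "has_leb_density reference r"
    and cost: "transport_cost reference = ereal bound
      + ereal \<epsilon> * enn2ereal (\<integral>\<^sup>+z. ennreal (kl_integrand (r z) (reference_pdf z)) \<partial>lborel)"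
    using transport_cost_eq[OF ref has_leb_density_reference] .
  have [measurable]: "r \<in> borel_measurable borel" and r0: "\<And>z. 0 \<le> r z"
    and dens: "density lborel (\<lambda>z. ennreal (reference_pdf z)) = density lborel (\<lambda>z. ennreal (r z))"
    using r by (auto simp: has_leb_density_def reference_def)
  \<comment> \<open>The density \<open>r\<close> chosen inside \<open>entropy_H\<close> agrees with
    \<open>reference_pdf\<close> almost everywhere, which suffices for the relative entropy to
    vanish.\<close>
  have "AE z in lborel. ennreal (reference_pdf z) = ennreal (r z)"
    using dens by (intro sigma_finite_measure.density_unique[OF sigma_finite_lborel]) auto
  then have "AE z in lborel. ennreal (kl_integrand (r z) (reference_pdf z)) = 0"
  proof (rule AE_mp, intro AE_I2 impI)
    fix z assume "ennreal (reference_pdf z) = ennreal (r z)"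
    then have "r z = reference_pdf z" using r0[of z] reference_pdf_pos[of z] by simp
    then show "ennreal (kl_integrand (r z) (reference_pdf z)) = 0"
      using reference_pdf_pos[of z] by (simp add: kl_integrand_def)
  qed
  then have "(\<integral>\<^sup>+z. ennreal (kl_integrand (r z) (reference_pdf z)) \<partial>lborel) = 0"
    by (subst nn_integral_cong_AE[where v="\<lambda>_. 0"]) auto
  then have "transport_cost reference = ereal bound"
    using cost by (simp add: zero_ennreal.rep_eq)
  then have "entropic_W2 \<epsilon> P Q \<le> ereal bound"
    unfolding entropic_W2_eq_INF using ref by (metis INF_lower)
  then show "entropic_W2 \<epsilon> P Q = ereal bound" using entropic_W2_ge by (rule antisym)
qed

end

theorem theorem2:
  fixes P Q :: "(real^'n) measure" and \<epsilon> :: real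
    and \<mu>1 \<mu>2 :: "real^'n" and \<Sigma>1 \<Sigma>2 X :: "real^'n^'n"
  assumes "prob_space P" "sets P = sets borel"
    and "prob_space Q" "sets Q = sets borel"
    and "integrable P (\<lambda>x. (norm x)\<^sup>2)" "integrable Q (\<lambda>x. (norm x)\<^sup>2)"
    and "\<mu>1 = mean_vec P" "\<mu>2 = mean_vec Q"
    and "\<Sigma>1 = cov_mat P" "\<Sigma>2 = cov_mat Q"
    and "pos_def_mat \<Sigma>1" "pos_def_mat \<Sigma>2"
    and "\<epsilon> > 0"
    and "X = matrix_inv (msqrt \<Sigma>1) **
             msqrt (msqrt \<Sigma>1 ** \<Sigma>2 ** msqrt \<Sigma>1 + mat ((\<epsilon>/4)\<^sup>2)) **
             matrix_inv (msqrt \<Sigma>1)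
           - (\<epsilon>/4) *\<^sub>R matrix_inv \<Sigma>1"
  shows "entropic_W2 \<epsilon> P Q \<ge>
           ereal ((norm (\<mu>1 - \<mu>2))\<^sup>2 + trace \<Sigma>1 + trace \<Sigma>2 - 2 * trace (\<Sigma>1 ** X)
             - (\<epsilon>/2) * ln ((2 * pi * exp 1) ^ (2 * CARD('n)) * (\<epsilon>/2) ^ CARD('n) * det (\<Sigma>1 ** X)))
       \<and> (entropic_W2 \<epsilon> P Q =
           ereal ((norm (\<mu>1 - \<mu>2))\<^sup>2 + trace \<Sigma>1 + trace \<Sigma>2 - 2 * trace (\<Sigma>1 ** X)
             - (\<epsilon>/2) * ln ((2 * pi * exp 1) ^ (2 * CARD('n)) * (\<epsilon>/2) ^ CARD('n) * det (\<Sigma>1 ** X)))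
          \<longleftrightarrow> is_gaussian P \<and> is_gaussian Q)"
proof -
  have X: "pos_def_mat X" "X ** \<Sigma>1 ** X + (\<epsilon>/2) *\<^sub>R X = \<Sigma>2"
    using entropic_transport_matrix[OF assms(11-14)] .
  interpret entropic_transport P Q \<epsilon> \<mu>1 \<mu>2 \<Sigma>1 \<Sigma>2 X
    by (intro entropic_transport.intro) (fact assms X)+
  show ?thesis
    using entropic_W2_ge entropic_W2_eq_bound_iff unfolding bound_def by blast
qed

end
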